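(* Let $n\geq2$. The set $\mathcal{M}_n$ is the union of $\mathcal{E}_n$ together with one point on the relative boundary of $\mathcal{E}_n$ in $S_n$, this point being given by $\partial\mathcal{E}_n\cap\left\{w:|w|=\frac{n-1}{n+1}\right\}$, where $\partial\mathcal{E}_n$ denotes the relative boundary of $\mathcal{E}_n$ in $S_n$.
   Context: $\mathbb{D}$ is the open unit disk in $\mathbb{C}$. For $w\in\mathbb{D}$ and an integer $n\geq2$, let $B_w(z)=\left(\frac{z-w}{1-\overline{w}z}\right)^n$, a holomorphic self-map of $\mathbb{D}$ that is also a rational map of $\overline{\mathbb{C}}$. Its Denjoy–Wolff point is the point $z_0\in\overline{\mathbb{D}}$ such that $B_w^k(z)\to z_0$ as $k\to\infty$ for every $z\in\mathbb{D}$ (iterates). $B_w$ is called elliptic if $z_0\in\mathbb{D}$. The Julia set $J(B_w)$ is the complement in $\overline{\mathbb{C}}$ of the set of points having a neighbourhood on which the family of iterates $(B_w^k)_{k\geq1}$ is normal. Let \[ S_n=\left\{w\in\mathbb{D}:\arg(w)\in\left[0,\tfrac{2\pi}{n-1}\right)\right\}, \] with the convention $0\in S_n$, and let \[ \mathcal{E}_n=\{w\in S_n:B_w\text{ is elliptic}\},\qquad \mathcal{M}_n=\{w\in S_n: J(B_w)=\partial\mathbb{D}\}. \] The relative boundary of $\mathcal{E}_n$ in $S_n$ is its topological boundary in the subspace $S_n$ of $\mathbb{C}$. *)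

theory Defs
  imports "HOL-Analysis.Analysis"
begin

datatype riemann_sphere = Fin complex | Infty

text \<open>Inverse stereographic projection onto the unit sphere of \<open>complex \<times> real\<close>, which is
  Euclidean 3-space; the metric below is the resulting chordal metric.\<close>

fun stereo :: "riemann_sphere \<Rightarrow> complex \<times> real" where
  "stereo (Fin z) = ((2 / (1 + (norm z)\<^sup>2)) *\<^sub>R z, ((norm z)\<^sup>2 - 1) / ((norm z)\<^sup>2 + 1))"
| "stereo Infty = (0, 1)"

lemma stereo_Fin_snd: "snd (stereo (Fin z)) = 1 - 2 / (1 + (norm z)\<^sup>2)"
proof -
  have "1 + (norm z)\<^sup>2 \<noteq> 0"
    by (smt (verit) zero_le_power2)
  then show ?thesis
    by (simp add: field_simps)
qed

lemma stereo_eq_iff: "stereo p = stereo q \<longleftrightarrow> p = q"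
proof
  have pos: "1 + (norm z)\<^sup>2 > 0" for z :: complex
    by (smt (verit) zero_le_power2)
  have ne: "stereo (Fin z) \<noteq> stereo Infty" for z
  proof
    assume "stereo (Fin z) = stereo Infty"
    then have "snd (stereo (Fin z)) = 1" by simp
    then show False using pos[of z] unfolding stereo_Fin_snd by simp
  qed
  assume eq: "stereo p = stereo q"
  show "p = q"
  proof (cases p; cases q)
    fix z u assume pq: "p = Fin z" "q = Fin u"
    from eq have "snd (stereo (Fin z)) = snd (stereo (Fin u))" by (simp add: pq)
    then have "2 / (1 + (norm z)\<^sup>2) = 2 / (1 + (norm u)\<^sup>2)"
      unfolding stereo_Fin_snd by simp
    moreover have "(2 / (1 + (norm z)\<^sup>2)) *\<^sub>R z = (2 / (1 + (norm u)\<^sup>2)) *\<^sub>R u"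
      using eq by (simp add: pq)
    ultimately have "(2 / (1 + (norm u)\<^sup>2)) *\<^sub>R z = (2 / (1 + (norm u)\<^sup>2)) *\<^sub>R u"
      by metis
    moreover have "2 / (1 + (norm u)\<^sup>2) \<noteq> 0" using pos[of u] by simp
    ultimately show "p = q" unfolding pq by (metis real_vector.scale_cancel_left)
  next
    fix z assume "p = Fin z" "q = Infty" then show "p = q" using eq ne by metis
  next
    fix u assume "p = Infty" "q = Fin u" then show "p = q" using eq ne by metis
  next
    assume "p = Infty" "q = Infty" then show "p = q" by simp
  qed
qed simp

instantiation riemann_sphere :: metric_space
begin

definition dist_riemann_sphere :: "riemann_sphere \<Rightarrow> riemann_sphere \<Rightarrow> real" where
  "dist_riemann_sphere p q = dist (stereo p) (stereo q)"

definition uniformity_riemann_sphere :: "(riemann_sphere \<times> riemann_sphere) filter" where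
  "uniformity_riemann_sphere = (INF e\<in>{0<..}. principal {(p, q). dist p q < e})"

definition open_riemann_sphere :: "riemann_sphere set \<Rightarrow> bool" where
  "open_riemann_sphere U = (\<forall>p\<in>U. \<forall>\<^sub>F (p', q) in uniformity. p' = p \<longrightarrow> q \<in> U)"

instance
proof
  fix p q r :: riemann_sphere
  show "dist p q = 0 \<longleftrightarrow> p = q"
    by (simp add: dist_riemann_sphere_def stereo_eq_iff)
  show "dist p q \<le> dist p r + dist q r"
    by (simp add: dist_riemann_sphere_def dist_triangle2)
qed (simp_all add: uniformity_riemann_sphere_def open_riemann_sphere_def)

end

text \<open>Locally uniform convergence with respect to the chordal metric is expressed as uniform
  convergence on compact subsets; the two agree on open sets because the sphere is locally compact.
  The limit takes values in the sphere, so \<open>Infty\<close> is an admissible limit value.\<close>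

definition normal_family_on ::
    "riemann_sphere set \<Rightarrow> (riemann_sphere \<Rightarrow> riemann_sphere) set \<Rightarrow> bool" where
  "normal_family_on U \<F> \<longleftrightarrow>
     (\<forall>f :: nat \<Rightarrow> riemann_sphere \<Rightarrow> riemann_sphere. range f \<subseteq> \<F> \<longrightarrow>
        (\<exists>r :: nat \<Rightarrow> nat. \<exists>g. strict_mono r \<and>
           (\<forall>K. compact K \<and> K \<subseteq> U \<longrightarrow> uniform_limit K (\<lambda>i. f (r i)) g sequentially)))"

definition julia_set :: "(riemann_sphere \<Rightarrow> riemann_sphere) \<Rightarrow> riemann_sphere set" where
  "julia_set f = - {p. \<exists>U. open U \<and> p \<in> U \<and> normal_family_on U {f ^^ k | k. k \<ge> 1}}"

definition is_denjoy_wolff_point :: "(complex \<Rightarrow> complex) \<Rightarrow> complex \<Rightarrow> bool" where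
  "is_denjoy_wolff_point f z0 \<longleftrightarrow>
     z0 \<in> cball 0 1 \<and> (\<forall>z\<in>ball 0 1. (\<lambda>k. (f ^^ k) z) \<longlonglongrightarrow> z0)"

definition elliptic :: "(complex \<Rightarrow> complex) \<Rightarrow> bool" where
  "elliptic f \<longleftrightarrow> (\<exists>z0\<in>ball 0 1. is_denjoy_wolff_point f z0)"

definition blaschke :: "nat \<Rightarrow> complex \<Rightarrow> complex \<Rightarrow> complex" where
  "blaschke n w z = ((z - w) / (1 - cnj w * z)) ^ n"

text \<open>The same rational map on the whole sphere, for \<open>n \<ge> 1\<close> and \<open>norm w < 1\<close>: its only pole is
  \<open>1 / cnj w\<close> (it is \<open>Infty\<close> if \<open>w = 0\<close>), and its value at \<open>Infty\<close> is the limit of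
  \<open>blaschke n w z\<close> as \<open>z\<close> tends to infinity.\<close>

fun blaschke_sphere :: "nat \<Rightarrow> complex \<Rightarrow> riemann_sphere \<Rightarrow> riemann_sphere" where
  "blaschke_sphere n w (Fin z) =
     (if 1 - cnj w * z = 0 then Infty else Fin (blaschke n w z))"
| "blaschke_sphere n w Infty =
     (if w = 0 then Infty else Fin ((- 1 / cnj w) ^ n))"

text \<open>\<open>Arg2pi\<close> takes values in \<open>[0, 2\<pi>)\<close> and \<open>Arg2pi 0 = 0\<close>, so \<open>0\<close> lies in the sector.\<close>

definition sector :: "nat \<Rightarrow> complex set" where
  "sector n = {w \<in> ball 0 1. Arg2pi w \<in> {0..<2 * pi / (real n - 1)}}"

definition elliptic_locus :: "nat \<Rightarrow> complex set" where
  "elliptic_locus n = {w \<in> sector n. elliptic (blaschke n w)}"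

definition circle_julia_locus :: "nat \<Rightarrow> complex set" where
  "circle_julia_locus n = {w \<in> sector n. julia_set (blaschke_sphere n w) = Fin ` sphere 0 1}"

end

theory Submission
  imports Defs "HOL-Complex_Analysis.Great_Picard"
begin

text \<open>
  Write \<open>B\<close> for \<open>blaschke n w\<close>. It is a disc automorphism followed by the \<open>n\<close>-th power, and both
  factors interact explicitly with \<open>horo a z = |z - a|\<^sup>2 / (1 - |z|\<^sup>2)\<close>: an automorphism multiplies it by a
  constant, and the power map contracts it by a strict Cauchy--Schwarz inequality. This gives a
  Schwarz--Pick lemma (for \<open>a\<close> in the disc) and a Julia lemma (for \<open>a\<close> on the circle) in one statement,
  \<open>horo_blaschke_less\<close>, whose constant \<open>dilation n w a\<close> is \<open>(1 - |B a|\<^sup>2) / (1 - |a|\<^sup>2)\<close> inside the disc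
  and \<open>|B' a|\<close> on the circle. Brouwer's fixed point theorem applied to \<open>t B\<close>, with \<open>t\<close> increasing to
  \<open>1\<close>, produces a fixed point with dilation at most \<open>1\<close>, and every such point attracts the whole disc. So \<open>B\<close>
  is non-elliptic exactly when some fixed point on the circle has \<open>|B' a| \<le> 1\<close>
  (\<open>not_elliptic_iff\<close>).

  On the circle \<open>|B' a| = n (1 - |w|\<^sup>2) / |1 - cnj w a|\<^sup>2 \<ge> n (1 - |w|) / (1 + |w|)\<close>. Below the radius
  \<open>(n - 1) / (n + 1)\<close> this exceeds \<open>1\<close>, so \<open>B\<close> is elliptic. At that radius \<open>B\<close> can fail to be elliptic only
  if the point \<open>a = - w / |w|\<close>, where equality holds, is fixed. As \<open>B a = a ^ n\<close> there, this
  means \<open>a ^ (n - 1) = 1\<close>, and the sector contains exactly one such parameter, \<open>parabolic_param n\<close>. Since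
  ellipticity is an open condition, \<open>parabolic_param n\<close> is the only point of the relative boundary on that circle.

  For the Julia set, Montel's theorem puts the disc, hence by reflection also the exterior, into the
  Fatou set, so only the circle is in question. If the iterates are normal at a circle point, a
  subsequence converges near it, uniformly on the closed disc side, to the Denjoy--Wolff point.
  In the elliptic case that point lies off the circle, while the circle is invariant. For \<open>parabolic_param n\<close> the
  map does not contract arclength on the circle, which is incompatible with an arc shrinking to a point
  (\<open>circle_subset_julia_expanding\<close>).

  For the other non-elliptic parameters some circle point lies in the Fatou set
  (\<open>circle_point_in_fatou_set\<close>). In the coordinate \<open>T = a / (z - a)\<close>, which sends the
  boundary fixed point \<open>a\<close> to infinity and the circle to a vertical line, \<open>B\<close> has the form
  \<open>T \<mapsto> (T + \<i> y) / d + const + o(1)\<close> with \<open>const\<close> real and \<open>d = |B' a|\<close>.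
  If \<open>d < 1\<close>, or if \<open>d = 1\<close> and \<open>y \<noteq> 0\<close>, then a half plane \<open>\<plusminus> Im T > R\<close> is invariant. It is a bounded
  region of the \<open>z\<close>-plane that meets the circle, so Montel's theorem applies to it. The remaining
  case \<open>d = 1\<close> and \<open>y = 0\<close> forces \<open>w = - (n - 1) / (n + 1) * a\<close>, which is \<open>parabolic_param n\<close>.
\<close>

section \<open>A Schwarz--Pick--Julia inequality\<close>

definition mob :: "complex \<Rightarrow> complex \<Rightarrow> complex" where
  "mob w z = (z - w) / (1 - cnj w * z)"

lemma blaschke_eq_mob: "blaschke n w z = mob w z ^ n"
  by (simp add: blaschke_def mob_def)

lemma mob_denom_nonzero:
  assumes "norm w < 1" "norm z \<le> 1"
  shows "1 - cnj w * z \<noteq> 0"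
proof
  assume "1 - cnj w * z = 0"
  then have "norm (cnj w * z) = 1" by (metis eq_iff_diff_eq_0 norm_one)
  moreover have "norm (cnj w * z) \<le> norm w * 1"
    unfolding norm_mult complex_mod_cnj by (intro mult_left_mono assms) auto
  ultimately show False using assms by simp
qed

lemma norm_mob_identity:
  "(norm (1 - cnj w * z))\<^sup>2 - (norm (z - w))\<^sup>2 = (1 - (norm w)\<^sup>2) * (1 - (norm z)\<^sup>2)"
  unfolding cmod_power2 by (simp add: power2_eq_square algebra_simps)

lemma one_minus_norm_mob:
  assumes "1 - cnj w * z \<noteq> 0"
  shows "1 - (norm (mob w z))\<^sup>2 = (1 - (norm w)\<^sup>2) * (1 - (norm z)\<^sup>2) / (norm (1 - cnj w * z))\<^sup>2"
  using assms norm_mob_identity[of w z]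
  by (simp add: mob_def norm_divide power_divide divide_simps)

lemma norm_mob_less_1:
  assumes "norm w < 1" "norm z < 1"
  shows "norm (mob w z) < 1"
proof -
  have nz: "1 - cnj w * z \<noteq> 0" using assms mob_denom_nonzero by simp
  have "0 < (1 - (norm w)\<^sup>2) * (1 - (norm z)\<^sup>2) / (norm (1 - cnj w * z))\<^sup>2"
    using assms nz by (intro divide_pos_pos mult_pos_pos) (simp_all add: power_less_one_iff abs_square_less_1)
  then have "(norm (mob w z))\<^sup>2 < 1" using one_minus_norm_mob[OF nz] by linarith
  then show ?thesis by (simp add: abs_square_less_1)
qed

lemma norm_mob_eq_1:
  assumes "norm w < 1" "norm z = 1"
  shows "norm (mob w z) = 1"
proof -
  have "1 - (norm (mob w z))\<^sup>2 = 0"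
    using one_minus_norm_mob[OF mob_denom_nonzero, of w z] assms by simp
  then show ?thesis by (simp add: power2_eq_1_iff) (smt (verit) norm_ge_zero)
qed

lemma norm_blaschke_less_1:
  assumes "norm w < 1" "norm z < 1" "n \<ge> 1"
  shows "norm (blaschke n w z) < 1"
  using norm_mob_less_1[OF assms(1,2)] assms(3)
  by (simp add: blaschke_eq_mob norm_power power_less_one_iff)

lemma norm_blaschke_eq_1:
  assumes "norm w < 1" "norm z = 1"
  shows "norm (blaschke n w z) = 1"
  using norm_mob_eq_1[OF assms] by (simp add: blaschke_eq_mob norm_power)

lemma norm_blaschke_le_1:
  assumes "norm w < 1" "norm z \<le> 1" "n \<ge> 1"
  shows "norm (blaschke n w z) \<le> 1"
  using norm_blaschke_less_1[of w z n] norm_blaschke_eq_1[of w z n] assms by force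

lemma mob_diff:
  assumes "1 - cnj w * z \<noteq> 0" "1 - cnj w * a \<noteq> 0"
  shows "mob w z - mob w a
    = (z - a) * of_real (1 - (norm w)\<^sup>2) / ((1 - cnj w * z) * (1 - cnj w * a))"
proof -
  have *: "complex_of_real (1 - (norm w)\<^sup>2) = 1 - w * cnj w"
    by (metis complex_norm_square of_real_1 of_real_diff)
  show ?thesis using assms unfolding mob_def * by (simp add: divide_simps) algebra
qed

text \<open>Cauchy--Schwarz for the vectors \<open>(1, a, ..., a ^ (n - 1))\<close> and
  \<open>(b ^ (n - 1), ..., b, 1)\<close>. The strictness is what makes the power map a strict contraction below; it
  comes from \<open>a < 1\<close>, which keeps the two vectors from being proportional.\<close>

lemma sum_powers_Cauchy_Schwarz_strict:
  fixes a b :: real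
  assumes "0 \<le> a" "a < 1" "0 \<le> b" "b \<le> 1" "n \<ge> 2"
  shows "(\<Sum>k<n. b ^ (n - Suc k) * a ^ k)\<^sup>2 < (\<Sum>k<n. (a\<^sup>2) ^ k) * (\<Sum>k<n. (b\<^sup>2) ^ k)"
proof -
  define P where "P = (\<Sum>k<n. b ^ (n - Suc k) * a ^ k)"
  define X where "X = (\<Sum>k<n. (a\<^sup>2) ^ k)"
  define Y where "Y = (\<Sum>k<n. (b\<^sup>2) ^ k)"
  have Y': "Y = (\<Sum>k<n. (b ^ (n - Suc k))\<^sup>2)"
    unfolding Y_def by (subst sum.nat_diff_reindex[symmetric]) (simp add: power_mult[symmetric] mult.commute)
  have "Y > 0"
  proof -
    have "(\<Sum>k<n. (b\<^sup>2) ^ k) \<ge> (\<Sum>k\<in>{0}. (b\<^sup>2) ^ k)"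
      using assms by (intro sum_mono2) auto
    then show ?thesis unfolding Y_def by simp
  qed
  \<comment> \<open>\<open>t\<close> minimises the quadratic polynomial \<open>X - 2 t P + t\<^sup>2 Y\<close>\<close>
  define t where "t = P / Y"
  have eq: "(\<Sum>k<n. (a ^ k - t * b ^ (n - Suc k))\<^sup>2) = X - 2 * t * P + t\<^sup>2 * Y"
    unfolding X_def Y' P_def
    by (simp add: power2_diff power_mult_distrib sum.distrib sum_subtractf sum_distrib_left
        power_mult[symmetric] mult_ac)
  have "(\<Sum>k<n. (a ^ k - t * b ^ (n - Suc k))\<^sup>2) > 0"
  proof (rule ccontr)
    assume "\<not> ?thesis"
    then have "(\<Sum>k<n. (a ^ k - t * b ^ (n - Suc k))\<^sup>2) = 0"
      by (meson not_less order_antisym sum_nonneg zero_le_power2)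
    then have z: "a ^ k = t * b ^ (n - Suc k)" if "k < n" for k
      using that by (subst (asm) sum_nonneg_eq_0_iff) auto
    \<comment> \<open>the first and the last coordinate alone are already incompatible\<close>
    have "1 = t * b ^ (n - 1)" using z[of 0] assms by simp
    moreover have "a ^ (n - 1) = t" using z[of "n - 1"] assms by simp
    ultimately have "1 = a ^ (n - 1) * b ^ (n - 1)" by simp
    moreover have "a ^ (n - 1) * b ^ (n - 1) \<le> a ^ (n - 1) * 1"
      using assms by (intro mult_left_mono power_le_one) auto
    moreover have "a ^ (n - 1) < 1" using assms by (simp add: power_less_one_iff)
    ultimately show False by linarith
  qed
  then have "0 < X - 2 * t * P + t\<^sup>2 * Y" unfolding eq .
  also have "\<dots> = X - P\<^sup>2 / Y"
    unfolding t_def using \<open>Y > 0\<close> by (simp add: power2_eq_square)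
  finally have "0 < X - P\<^sup>2 / Y" .
  then have "P\<^sup>2 < X * Y" using \<open>Y > 0\<close> by (simp add: divide_simps)
  then show ?thesis unfolding P_def X_def Y_def .
qed

text \<open>The two geometric sums are \<open>(1 - |u| ^ (2 n)) / (1 - |u|\<^sup>2)\<close> and its analogue for \<open>v\<close>, so for \<open>v\<close> in
  the disc this is the Schwarz--Pick inequality for the power map. In summed form it still makes sense
  for \<open>|v| = 1\<close>, where the last factor becomes \<open>n\<close>.\<close>

lemma norm_power_diff_less:
  fixes u v :: complex
  assumes "norm u < 1" "norm v \<le> 1" "u \<noteq> v" "n \<ge> 2"
  shows "(norm (u ^ n - v ^ n))\<^sup>2
    < (norm (u - v))\<^sup>2 * (\<Sum>k<n. ((norm u)\<^sup>2) ^ k) * (\<Sum>k<n. ((norm v)\<^sup>2) ^ k)"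
proof -
  have "norm (\<Sum>k<n. v ^ (n - Suc k) * u ^ k) \<le> (\<Sum>k<n. norm v ^ (n - Suc k) * norm u ^ k)"
    by (rule sum_norm_le) (simp add: norm_mult norm_power)
  then have "(norm (\<Sum>k<n. v ^ (n - Suc k) * u ^ k))\<^sup>2
      \<le> (\<Sum>k<n. norm v ^ (n - Suc k) * norm u ^ k)\<^sup>2"
    by (rule power_mono) simp
  also have "\<dots> < (\<Sum>k<n. ((norm u)\<^sup>2) ^ k) * (\<Sum>k<n. ((norm v)\<^sup>2) ^ k)"
    using assms by (intro sum_powers_Cauchy_Schwarz_strict) auto
  finally have "(norm (u - v))\<^sup>2 * (norm (\<Sum>k<n. v ^ (n - Suc k) * u ^ k))\<^sup>2
      < (norm (u - v))\<^sup>2 * ((\<Sum>k<n. ((norm u)\<^sup>2) ^ k) * (\<Sum>k<n. ((norm v)\<^sup>2) ^ k))"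
    using assms(3) by (intro mult_strict_left_mono) auto
  then show ?thesis
    by (simp add: power_diff_sumr2 norm_mult power_mult_distrib mult.assoc)
qed

text \<open>The level sets are horocycles at \<open>a\<close> if \<open>|a| = 1\<close> and hyperbolic circles around \<open>a\<close> if
  \<open>|a| < 1\<close>.\<close>

definition horo :: "complex \<Rightarrow> complex \<Rightarrow> real" where
  "horo a z = (norm (z - a))\<^sup>2 / (1 - (norm z)\<^sup>2)"

text \<open>This is the modulus of the derivative on the unit circle and the quotient
  \<open>(1 - |B a|\<^sup>2) / (1 - |a|\<^sup>2)\<close> in the disc; the formula extends both continuously to the closed disc, so
  that a limit of interior points may be taken without a case distinction.\<close>

definition dilation :: "nat \<Rightarrow> complex \<Rightarrow> complex \<Rightarrow> real" where
  "dilation n w a = (1 - (norm w)\<^sup>2) / (norm (1 - cnj w * a))\<^sup>2 * (\<Sum>k<n. ((norm (mob w a))\<^sup>2) ^ k)"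

lemma one_minus_norm_blaschke:
  "1 - (norm (blaschke n w z))\<^sup>2 = (1 - (norm (mob w z))\<^sup>2) * (\<Sum>k<n. ((norm (mob w z))\<^sup>2) ^ k)"
proof -
  have "(norm (blaschke n w z))\<^sup>2 = ((norm (mob w z))\<^sup>2) ^ n"
    by (simp add: blaschke_eq_mob norm_power power_mult[symmetric] mult.commute)
  then show ?thesis by (simp add: one_diff_power_eq)
qed

lemma dilation_in_disc:
  assumes "norm w < 1" "norm a < 1"
  shows "dilation n w a = (1 - (norm (blaschke n w a))\<^sup>2) / (1 - (norm a)\<^sup>2)"
proof -
  have nz: "1 - cnj w * a \<noteq> 0" using assms mob_denom_nonzero by simp
  have "(norm a)\<^sup>2 < 1" using assms by (simp add: abs_square_less_1)
  then show ?thesis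
    unfolding dilation_def one_minus_norm_blaschke one_minus_norm_mob[OF nz]
    using nz by (simp add: divide_simps)
qed

lemma dilation_on_circle:
  assumes "norm w < 1" "norm a = 1"
  shows "dilation n w a = real n * (1 - (norm w)\<^sup>2) / (norm (1 - cnj w * a))\<^sup>2"
  using norm_mob_eq_1[OF assms] by (simp add: dilation_def)

text \<open>The automorphism scales \<open>horo\<close> by \<open>(1 - |w|\<^sup>2) / |1 - cnj w a|\<^sup>2\<close>, and the power map multiplies it by
  less than the geometric sum at \<open>mob w a\<close>. The product of the two factors is the dilation.\<close>

lemma horo_blaschke_less:
  assumes w: "norm w < 1" and z: "norm z < 1" and a: "norm a \<le> 1" and "z \<noteq> a" "n \<ge> 2"
  shows "horo (blaschke n w a) (blaschke n w z) < dilation n w a * horo a z"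
proof -
  define u v where "u = mob w z" and "v = mob w a"
  define c where "c = 1 - (norm w)\<^sup>2"
  have nz: "1 - cnj w * z \<noteq> 0" "1 - cnj w * a \<noteq> 0"
    using mob_denom_nonzero[OF w] z a by auto
  have c: "c > 0" unfolding c_def using w by (simp add: abs_square_less_1)
  have zz: "1 - (norm z)\<^sup>2 > 0" using z by (simp add: abs_square_less_1)
  have nd: "norm (u - v) = norm (z - a) * c / (norm (1 - cnj w * z) * norm (1 - cnj w * a))"
    unfolding u_def v_def mob_diff[OF nz] norm_mult norm_divide norm_of_real
    using c by (simp add: c_def)
  have uv: "u \<noteq> v" using nd \<open>z \<noteq> a\<close> c nz by auto
  have u1: "norm u < 1" unfolding u_def by (rule norm_mob_less_1[OF w z])
  have v1: "norm v \<le> 1"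
    unfolding v_def using norm_mob_less_1[OF w, of a] norm_mob_eq_1[OF w, of a] a by force
  define S where "S = (\<lambda>x. \<Sum>k<n. ((norm (x::complex))\<^sup>2) ^ k)"
  have Spos: "S u > 0"
  proof -
    have "(\<Sum>k<n. ((norm u)\<^sup>2) ^ k) \<ge> (\<Sum>k\<in>{0}. ((norm u)\<^sup>2) ^ k)"
      using \<open>n \<ge> 2\<close> by (intro sum_mono2) auto
    then show ?thesis unfolding S_def by simp
  qed
  have uu: "1 - (norm u)\<^sup>2 = c * (1 - (norm z)\<^sup>2) / (norm (1 - cnj w * z))\<^sup>2"
    unfolding u_def c_def by (rule one_minus_norm_mob[OF nz(1)])
  have uup: "1 - (norm u)\<^sup>2 > 0" using u1 by (simp add: abs_square_less_1)
  have "horo (blaschke n w a) (blaschke n w z) = (norm (u ^ n - v ^ n))\<^sup>2 / ((1 - (norm u)\<^sup>2) * S u)"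
    unfolding horo_def one_minus_norm_blaschke S_def u_def v_def by (simp add: blaschke_eq_mob)
  also have "\<dots> < ((norm (u - v))\<^sup>2 * S u * S v) / ((1 - (norm u)\<^sup>2) * S u)"
    using norm_power_diff_less[OF u1 v1 uv \<open>n \<ge> 2\<close>] Spos uup
    by (intro divide_strict_right_mono) (auto simp: S_def)
  also have "\<dots> = (norm (u - v))\<^sup>2 / (1 - (norm u)\<^sup>2) * S v" using Spos by simp
  also have "(norm (u - v))\<^sup>2 / (1 - (norm u)\<^sup>2) = c / (norm (1 - cnj w * a))\<^sup>2 * horo a z"
    unfolding uu nd horo_def using nz c zz by (simp add: divide_simps power2_eq_square)
  also have "\<dots> * S v = dilation n w a * horo a z"
    unfolding dilation_def c_def S_def v_def by simp
  finally show ?thesis .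
qed

section \<open>The Denjoy--Wolff theorem for Blaschke powers\<close>

lemma continuous_on_blaschke:
  assumes "norm w < 1"
  shows "continuous_on (cball 0 1) (blaschke n w)"
  unfolding blaschke_def using mob_denom_nonzero[OF assms] by (intro continuous_intros) auto

lemma blaschke_tendsto:
  assumes "(f \<longlongrightarrow> w) F" "(g \<longlongrightarrow> z) F" "norm w < 1" "norm z \<le> 1"
  shows "((\<lambda>k. blaschke n (f k) (g k)) \<longlongrightarrow> blaschke n w z) F"
  unfolding blaschke_def using mob_denom_nonzero[OF assms(3,4)] assms(1,2)
  by (intro tendsto_intros) auto

lemma funpow_blaschke_in_disc:
  assumes "norm w < 1" "norm z < 1" "n \<ge> 1"
  shows "norm ((blaschke n w ^^ k) z) < 1"
  by (induction k) (use assms norm_blaschke_less_1 in auto)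

lemma compact_tendsto_if_unique_limit_point:
  fixes x :: "nat \<Rightarrow> 'a::metric_space"
  assumes "compact S" "\<And>k. x k \<in> S"
    and "\<And>r l'. strict_mono (r :: nat \<Rightarrow> nat) \<Longrightarrow> (x \<circ> r) \<longlonglongrightarrow> l' \<Longrightarrow> l' = l"
  shows "x \<longlonglongrightarrow> l"
proof (rule ccontr)
  assume "\<not> ?thesis"
  then obtain e where e: "e > 0" "\<And>N. \<exists>k\<ge>N. dist (x k) l \<ge> e"
    unfolding lim_sequentially by (meson not_le)
  then have "infinite {k. dist (x k) l \<ge> e}"
    unfolding infinite_nat_iff_unbounded_le by auto
  then obtain r :: "nat \<Rightarrow> nat" where r: "strict_mono r" "\<And>k. r k \<in> {k. dist (x k) l \<ge> e}"
    using infinite_enumerate by blast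
  obtain l' s where s: "strict_mono s" "((x \<circ> r) \<circ> s) \<longlonglongrightarrow> l'"
    using assms(1,2) unfolding compact_def by (metis comp_apply)
  then have "l' = l" using assms(3)[of "r \<circ> s" l'] r(1) by (simp add: strict_mono_o comp_assoc)
  then have "(\<lambda>k. dist (x (r (s k))) l) \<longlonglongrightarrow> 0"
    using s(2) tendsto_dist_iff by (force simp: o_def)
  then have "eventually (\<lambda>k. dist (x (r (s k))) l < e) sequentially"
    using e(1) order_tendstoD(2) by blast
  then show False using r(2) by (auto simp: eventually_sequentially not_le[symmetric])
qed

text \<open>Along an orbit \<open>horo a\<close> decreases to a limit. A limit point inside the disc other than \<open>a\<close> would be a
  point where \<open>horo a\<close> does not decrease strictly; at a limit point on the circle the denominator of
  \<open>horo a\<close> vanishes, so boundedness forces the numerator to vanish as well.\<close>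

theorem blaschke_iterates_tendsto:
  assumes w: "norm w < 1" and n: "n \<ge> 2" and a: "norm a \<le> 1" and fix_a: "blaschke n w a = a"
    and dil: "dilation n w a \<le> 1" and z: "norm z < 1"
  shows "(\<lambda>k. (blaschke n w ^^ k) z) \<longlonglongrightarrow> a"
proof (rule compact_tendsto_if_unique_limit_point[of "cball 0 1"])
  define x where "x = (\<lambda>k. (blaschke n w ^^ k) z)"
  have n1: "n \<ge> 1" using n by simp
  have x1: "norm (x k) < 1" for k
    unfolding x_def using funpow_blaschke_in_disc[OF w z n1] .
  then show "(blaschke n w ^^ k) z \<in> cball 0 1" for k unfolding x_def by (simp add: less_imp_le)
  have horo_ge: "horo a y \<ge> 0" if "norm y < 1" for y
    unfolding horo_def using that by (simp add: abs_square_le_1)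
  have dec: "horo a (blaschke n w y) \<le> horo a y" if "norm y < 1" for y
  proof (cases "y = a")
    case False
    have "horo a (blaschke n w y) < dilation n w a * horo a y"
      using horo_blaschke_less[OF w that a False n] fix_a by simp
    also have "\<dots> \<le> 1 * horo a y" using dil horo_ge[OF that] by (rule mult_right_mono)
    finally show ?thesis by simp
  qed (simp add: fix_a)
  have anti: "decseq (\<lambda>k. horo a (x k))"
    using dec[OF x1] by (intro decseq_SucI) (simp add: x_def)
  obtain L where L: "(\<lambda>k. horo a (x k)) \<longlonglongrightarrow> L" "\<And>k. L \<le> horo a (x k)"
    using decseq_convergent[OF anti, of 0] horo_ge[OF x1] by blast
  fix r l assume r: "strict_mono (r :: nat \<Rightarrow> nat)" and "((\<lambda>k. (blaschke n w ^^ k) z) \<circ> r) \<longlonglongrightarrow> l"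
  then have l: "(\<lambda>k. x (r k)) \<longlonglongrightarrow> l" by (simp add: x_def o_def)
  have "norm l \<le> 1"
    by (rule LIMSEQ_le_const2[OF tendsto_norm[OF l]]) (use x1 in \<open>auto intro: less_imp_le\<close>)
  show "l = a"
  proof (cases "norm l < 1")
    case True
    show "l = a"
    proof (rule ccontr)
      assume "l \<noteq> a"
      have l2: "(norm l)\<^sup>2 < 1" using True by (simp add: abs_square_less_1)
      have b1: "norm (blaschke n w l) < 1" by (rule norm_blaschke_less_1[OF w True n1])
      then have b2: "(norm (blaschke n w l))\<^sup>2 < 1" by (simp add: abs_square_less_1)
      have bl: "(\<lambda>k. blaschke n w (x (r k))) \<longlonglongrightarrow> blaschke n w l"
        using True by (intro blaschke_tendsto[OF tendsto_const l w]) simp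
      have "(\<lambda>k. horo a (x (r k))) \<longlonglongrightarrow> horo a l"
        unfolding horo_def using l2 by (intro tendsto_intros l) auto
      moreover have "(\<lambda>k. horo a (x (r k))) \<longlonglongrightarrow> L"
        using LIMSEQ_subseq_LIMSEQ[OF L(1) r] by (simp add: o_def)
      ultimately have hl: "horo a l = L" using LIMSEQ_unique by blast
      have "(\<lambda>k. horo a (blaschke n w (x (r k)))) \<longlonglongrightarrow> horo a (blaschke n w l)"
        unfolding horo_def using b2 by (intro tendsto_intros bl) auto
      moreover have "L \<le> horo a (blaschke n w (x (r k)))" for k
        using L(2)[of "Suc (r k)"] by (simp add: x_def)
      ultimately have "L \<le> horo a (blaschke n w l)"
        by (intro LIMSEQ_le_const) auto
      moreover have "horo a (blaschke n w l) < horo a l"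
      proof -
        have "horo a (blaschke n w l) < dilation n w a * horo a l"
          using horo_blaschke_less[OF w True a \<open>l \<noteq> a\<close> n] fix_a by simp
        also have "\<dots> \<le> 1 * horo a l" using dil horo_ge[OF True] by (rule mult_right_mono)
        finally show ?thesis by simp
      qed
      ultimately show False using hl by simp
    qed
  next
    case False
    then have l1: "norm l = 1" using \<open>norm l \<le> 1\<close> by simp
    have "(norm (x k - a))\<^sup>2 \<le> horo a (x 0) * (1 - (norm (x k))\<^sup>2)" for k
    proof -
      have "(norm (x k))\<^sup>2 < 1" using x1 by (simp add: abs_square_less_1)
      moreover have "horo a (x k) \<le> horo a (x 0)" using anti by (simp add: decseq_def)
      ultimately show ?thesis unfolding horo_def[of a "x k"] by (simp add: pos_divide_le_eq)
    qed
    moreover have "(\<lambda>k. (norm (x (r k) - a))\<^sup>2) \<longlonglongrightarrow> (norm (l - a))\<^sup>2"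
      by (intro tendsto_intros l)
    moreover have "(\<lambda>k. horo a (x 0) * (1 - (norm (x (r k)))\<^sup>2)) \<longlonglongrightarrow> horo a (x 0) * (1 - (norm l)\<^sup>2)"
      by (intro tendsto_intros l)
    ultimately have "(norm (l - a))\<^sup>2 \<le> horo a (x 0) * (1 - (norm l)\<^sup>2)"
      by (intro LIMSEQ_le) auto
    then show "l = a" using l1 by simp
  qed
qed simp

text \<open>A fixed point \<open>z\<close> of \<open>t B\<close> with \<open>t < 1\<close> satisfies \<open>|z| \<le> |B z|\<close>, hence has dilation at most
  \<open>1\<close>. Both properties survive the passage to a limit point as \<open>t\<close> tends to \<open>1\<close>.\<close>

theorem blaschke_denjoy_wolff_point_exists:
  assumes w: "norm w < 1" and n: "n \<ge> 2"
  obtains a where "norm a \<le> 1" "blaschke n w a = a" "dilation n w a \<le> 1"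
proof -
  have n1: "n \<ge> 1" using n by simp
  define t where "t = (\<lambda>k. 1 - inverse (real (Suc k)))"
  have t: "0 \<le> t k" "t k < 1" for k by (auto simp: t_def field_simps)
  have tlim: "t \<longlonglongrightarrow> 1"
    unfolding t_def using tendsto_diff[OF tendsto_const LIMSEQ_inverse_real_of_nat, of 1] by simp
  have "\<exists>z. z \<in> cball 0 1 \<and> t k *\<^sub>R blaschke n w z = z" for k
  proof -
    have "(\<lambda>z. t k *\<^sub>R blaschke n w z) \<in> cball 0 1 \<rightarrow> cball 0 1"
      using norm_blaschke_le_1[OF w _ n1] t[of k] by (auto intro!: mult_le_one)
    then show ?thesis
      using brouwer_ball[of 1 0 "\<lambda>z. t k *\<^sub>R blaschke n w z"]
        continuous_on_scaleR[OF continuous_on_const continuous_on_blaschke[OF w]] by (metis zero_less_one)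
  qed
  then obtain y where y: "\<And>k. y k \<in> cball 0 1" "\<And>k. t k *\<^sub>R blaschke n w (y k) = y k" by metis
  obtain a r where r: "a \<in> cball 0 1" "strict_mono (r :: nat \<Rightarrow> nat)" "(y \<circ> r) \<longlonglongrightarrow> a"
    using y(1) compact_cball[of "0::complex" 1] unfolding compact_def by metis
  have a: "norm a \<le> 1" using r(1) by simp
  have ylim: "(\<lambda>k. y (r k)) \<longlonglongrightarrow> a" using r(3) by (simp add: o_def)
  have tr: "(\<lambda>k. t (r k)) \<longlonglongrightarrow> 1" using LIMSEQ_subseq_LIMSEQ[OF tlim r(2)] by (simp add: o_def)
  have "(\<lambda>k. t (r k) *\<^sub>R blaschke n w (y (r k))) \<longlonglongrightarrow> 1 *\<^sub>R blaschke n w a"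
    by (rule tendsto_scaleR[OF tr blaschke_tendsto[OF tendsto_const ylim w a]])
  then have "(\<lambda>k. y (r k)) \<longlonglongrightarrow> blaschke n w a" by (simp add: y(2))
  then have fix_a: "blaschke n w a = a" by (rule LIMSEQ_unique[OF _ ylim])
  have dk: "dilation n w (y k) \<le> 1" for k
  proof -
    have b1: "norm (blaschke n w (y k)) \<le> 1" using norm_blaschke_le_1[OF w _ n1] y(1)[of k] by simp
    have yk: "norm (y k) = t k * norm (blaschke n w (y k))"
      using arg_cong[OF y(2)[of k], of norm] t[of k] by simp
    have le: "norm (y k) \<le> norm (blaschke n w (y k))"
      unfolding yk using t[of k] by (intro mult_left_le_one_le) auto
    have "norm (y k) \<le> t k * 1" unfolding yk using b1 t by (intro mult_left_mono) auto
    then have lt: "norm (y k) < 1" using t(2)[of k] by simp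
    then have "(norm (y k))\<^sup>2 < 1" by (simp add: abs_square_less_1)
    moreover have "(norm (y k))\<^sup>2 \<le> (norm (blaschke n w (y k)))\<^sup>2" using le by (intro power_mono) auto
    ultimately show ?thesis unfolding dilation_in_disc[OF w lt] by (simp add: divide_simps)
  qed
  have nz: "1 - cnj w * a \<noteq> 0" by (rule mob_denom_nonzero[OF w a])
  have "(\<lambda>k. dilation n w (y (r k))) \<longlonglongrightarrow> dilation n w a"
    unfolding dilation_def mob_def using nz by (intro tendsto_intros ylim) auto
  then have "dilation n w a \<le> 1" using dk by (intro LIMSEQ_le_const2) auto
  then show thesis using that a fix_a by blast
qed

section \<open>Ellipticity and the critical circle\<close>

lemma tendsto_not_elliptic:
  assumes "norm a = 1" "\<And>z. norm z < 1 \<Longrightarrow> (\<lambda>k. (f ^^ k) z) \<longlonglongrightarrow> a"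
  shows "\<not> elliptic f"
proof
  assume "elliptic f"
  then obtain z0 where "norm z0 < 1" "(\<lambda>k. (f ^^ k) 0) \<longlonglongrightarrow> z0"
    unfolding elliptic_def is_denjoy_wolff_point_def by auto
  then show False using LIMSEQ_unique[of "\<lambda>k. (f ^^ k) 0" z0 a] assms by auto
qed

theorem not_elliptic_iff:
  assumes w: "norm w < 1" and n: "n \<ge> 2"
  shows "\<not> elliptic (blaschke n w) \<longleftrightarrow>
    (\<exists>a. norm a = 1 \<and> blaschke n w a = a \<and> dilation n w a \<le> 1)"
proof
  assume ne: "\<not> elliptic (blaschke n w)"
  obtain a where a: "norm a \<le> 1" "blaschke n w a = a" "dilation n w a \<le> 1"
    using blaschke_denjoy_wolff_point_exists[OF w n] .
  have "\<not> norm a < 1"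
  proof
    assume "norm a < 1"
    then have "elliptic (blaschke n w)"
      unfolding elliptic_def is_denjoy_wolff_point_def
      using blaschke_iterates_tendsto[OF w n a] a by (intro bexI[of _ a]) auto
    then show False using ne by simp
  qed
  then show "\<exists>a. norm a = 1 \<and> blaschke n w a = a \<and> dilation n w a \<le> 1" using a by force
next
  assume "\<exists>a. norm a = 1 \<and> blaschke n w a = a \<and> dilation n w a \<le> 1"
  then obtain a where a: "norm a = 1" "blaschke n w a = a" "dilation n w a \<le> 1" by blast
  show "\<not> elliptic (blaschke n w)"
    using blaschke_iterates_tendsto[OF w n _ a(2,3)] a(1) by (intro tendsto_not_elliptic[OF a(1)]) simp
qed

text \<open>By compactness of the circle, boundary fixed points with dilation at most \<open>1\<close> of a convergent sequence of
  parameters accumulate at such a fixed point of the limiting map.\<close>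

lemma elliptic_open:
  assumes w: "norm w < 1" and n: "n \<ge> 2" and ell: "elliptic (blaschke n w)"
  shows "\<exists>e>0. \<forall>w'. norm w' < 1 \<and> dist w' w < e \<longrightarrow> elliptic (blaschke n w')"
proof (rule ccontr)
  assume "\<not> ?thesis"
  then have "\<exists>w'. norm w' < 1 \<and> dist w' w < inverse (real (Suc k)) \<and> \<not> elliptic (blaschke n w')" for k
    by (metis inverse_positive_iff_positive of_nat_0_less_iff zero_less_Suc)
  then obtain v where v: "\<And>k. norm (v k) < 1" "\<And>k. dist (v k) w < inverse (real (Suc k))"
    "\<And>k. \<not> elliptic (blaschke n (v k))" by metis
  have vlim: "v \<longlonglongrightarrow> w"
    by (rule metric_tendsto_imp_tendsto[OF LIMSEQ_inverse_real_of_nat])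
      (use v(2) in \<open>auto intro!: always_eventually less_imp_le\<close>)
  obtain a where a: "\<And>k. a k \<in> sphere 0 1" "\<And>k. blaschke n (v k) (a k) = a k"
      "\<And>k. dilation n (v k) (a k) \<le> 1"
    using v(3) not_elliptic_iff[OF v(1) n] unfolding mem_sphere_0 by metis
  obtain l r where r: "l \<in> sphere 0 1" "strict_mono (r :: nat \<Rightarrow> nat)" "(a \<circ> r) \<longlonglongrightarrow> l"
    using a(1) compact_sphere[of "0::complex" 1] unfolding compact_def by metis
  have l: "norm l = 1" using r(1) by simp
  have al: "(\<lambda>k. a (r k)) \<longlonglongrightarrow> l" using r(3) by (simp add: o_def)
  have vl: "(\<lambda>k. v (r k)) \<longlonglongrightarrow> w" using LIMSEQ_subseq_LIMSEQ[OF vlim r(2)] by (simp add: o_def)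
  have "(\<lambda>k. blaschke n (v (r k)) (a (r k))) \<longlonglongrightarrow> blaschke n w l"
    using l by (intro blaschke_tendsto[OF vl al w]) simp
  then have "(\<lambda>k. a (r k)) \<longlonglongrightarrow> blaschke n w l" by (simp add: a(2))
  then have fix_l: "blaschke n w l = l" by (rule LIMSEQ_unique[OF _ al])
  have nz: "1 - cnj w * l \<noteq> 0" using mob_denom_nonzero[OF w] l by simp
  have "(\<lambda>k. dilation n (v (r k)) (a (r k))) \<longlonglongrightarrow> dilation n w l"
    unfolding dilation_def mob_def using nz by (intro tendsto_intros vl al) auto
  then have "dilation n w l \<le> 1" using a(3) by (intro LIMSEQ_le_const2) auto
  then show False using not_elliptic_iff[OF w n] l fix_l ell by blast
qed

lemma dilation_on_circle_le_1_iff: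
  assumes "norm w < 1" "norm a = 1"
  shows "dilation n w a \<le> 1 \<longleftrightarrow> real n * (1 - (norm w)\<^sup>2) \<le> (norm (1 - cnj w * a))\<^sup>2"
  using mob_denom_nonzero[of w a] assms by (simp add: dilation_on_circle pos_divide_le_eq)

text \<open>The radius at which the smallest value of \<open>|B'|\<close> on the circle, \<open>n (1 - |w|) / (1 + |w|)\<close>,
  equals \<open>1\<close>.\<close>

definition critical_radius :: "nat \<Rightarrow> real" where "critical_radius n = (real n - 1) / (real n + 1)"

lemma critical_radius_bounds: "n \<ge> 2 \<Longrightarrow> 0 < critical_radius n \<and> critical_radius n < 1"
  unfolding critical_radius_def by (simp add: divide_simps)

lemma critical_radius_identity:
  assumes "n \<ge> 2"
  shows "real n * (1 - (critical_radius n)\<^sup>2) = (1 + critical_radius n)\<^sup>2"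
proof -
  have "real n * (1 - critical_radius n) = 1 + critical_radius n" unfolding critical_radius_def by (simp add: divide_simps)
  moreover have "real n * (1 - (critical_radius n)\<^sup>2) = (real n * (1 - critical_radius n)) * (1 + critical_radius n)"
    by (simp add: power2_eq_square algebra_simps)
  ultimately show ?thesis by (simp add: power2_eq_square)
qed

lemma dilation_le_1_imp_norm_ge:
  assumes w: "norm w < 1" and a: "norm a = 1" and dil: "dilation n w a \<le> 1"
  shows "norm w \<ge> (real n - 1) / (real n + 1)"
proof -
  have d: "real n * (1 - (norm w)\<^sup>2) \<le> (norm (1 - cnj w * a))\<^sup>2"
    using dil dilation_on_circle_le_1_iff[OF w a] by simp
  have "norm (1 - cnj w * a) \<le> 1 + norm w"
    using norm_triangle_ineq4[of 1 "cnj w * a"] a by (simp add: norm_mult)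
  then have "(norm (1 - cnj w * a))\<^sup>2 \<le> (1 + norm w)\<^sup>2" by (intro power_mono) auto
  then have "(1 + norm w) * (real n * (1 - norm w)) \<le> (1 + norm w) * (1 + norm w)"
    using d by (simp add: power2_eq_square algebra_simps)
  then have "real n * (1 - norm w) \<le> 1 + norm w"
    by (rule mult_left_le_imp_le) (smt (verit) norm_ge_zero)
  then show ?thesis by (simp add: divide_simps algebra_simps)
qed

text \<open>Equality in \<open>|1 - cnj w a| \<le> 1 + |w|\<close> holds only if \<open>w\<close> and \<open>a\<close> point in opposite directions.\<close>

lemma dilation_le_1_critical_norm:
  assumes w: "norm w < 1" and a: "norm a = 1" and dil: "dilation n w a \<le> 1" and n: "n \<ge> 2"
    and r: "norm w = (real n - 1) / (real n + 1)"
  shows "w = - of_real (norm w) * a"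
proof -
  have d: "real n * (1 - (norm w)\<^sup>2) \<le> (norm (1 - cnj w * a))\<^sup>2"
    using dil dilation_on_circle_le_1_iff[OF w a] by simp
  have e: "real n * (1 - norm w) = 1 + norm w" unfolding r by (simp add: divide_simps)
  have "real n * (1 - (norm w)\<^sup>2) = (real n * (1 - norm w)) * (1 + norm w)"
    by (simp add: power2_eq_square algebra_simps)
  then have d1: "(1 + norm w)\<^sup>2 \<le> (norm (1 - cnj w * a))\<^sup>2" using d e by (simp add: power2_eq_square)
  define c where "c = cnj w * a"
  have nc: "norm c = norm w" unfolding c_def by (simp add: norm_mult a)
  have "(norm (1 - c))\<^sup>2 = 1 - 2 * Re c + (norm c)\<^sup>2"
    unfolding cmod_power2 by (simp add: power2_eq_square algebra_simps)
  then have "Re c \<le> - norm c" using d1 nc unfolding c_def[symmetric] by (simp add: power2_eq_square algebra_simps)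
  then have rc: "Re c = - norm c" using abs_Re_le_cmod[of c] by linarith
  then have "Im c = 0" using cmod_power2[of c] by simp
  then have "c = - of_real (norm w)" using rc nc by (simp add: complex_eq_iff)
  then have "cnj c * a = - of_real (norm w) * a" by simp
  moreover have "cnj c * a = w"
    using a complex_norm_square[of a] unfolding c_def by (simp add: mult.assoc mult.commute)
  ultimately show ?thesis by simp
qed

lemma dilation_ge_1_on_critical_circle:
  assumes n: "n \<ge> 2" and w: "norm w = critical_radius n" and z: "norm z = 1"
  shows "dilation n w z \<ge> 1"
proof -
  have c: "0 < critical_radius n" "critical_radius n < 1" using critical_radius_bounds[OF n] by auto
  have w1: "norm w < 1" using w c by simp
  have nz: "1 - cnj w * z \<noteq> 0" using mob_denom_nonzero[OF w1] z by simp
  have "norm (1 - cnj w * z) \<le> 1 + critical_radius n"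
    using norm_triangle_ineq4[of 1 "cnj w * z"] z w by (simp add: norm_mult)
  then have "(norm (1 - cnj w * z))\<^sup>2 \<le> (1 + critical_radius n)\<^sup>2" by (intro power_mono) auto
  also have "\<dots> = real n * (1 - (norm w)\<^sup>2)" unfolding w by (rule critical_radius_identity[OF n, symmetric])
  finally show ?thesis unfolding dilation_on_circle[OF w1 z] using nz by (simp add: le_divide_eq_1_pos)
qed

lemma blaschke_antipodal:
  assumes "norm a = 1" "0 \<le> r" "r < 1"
  shows "blaschke n (- of_real r * a) a = a ^ n"
proof -
  have aa: "cnj a * a = 1" using assms(1) complex_norm_square[of a] by (simp add: mult.commute)
  have "complex_of_real (1 + r) \<noteq> 0" using assms by (simp del: of_real_add)
  then have "complex_of_real (1 + r) * a / of_real (1 + r) = a" by simp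
  moreover have "(a - (- of_real r * a)) = complex_of_real (1 + r) * a" by (simp add: algebra_simps)
  moreover have "1 - cnj (- of_real r * a) * a = complex_of_real (1 + r)" using aa by (simp add: mult.assoc)
  ultimately show ?thesis unfolding blaschke_def by metis
qed

lemma power_eq_self_iff:
  fixes a :: complex
  assumes "norm a = 1" "n \<ge> 1"
  shows "a ^ n = a \<longleftrightarrow> a ^ (n - 1) = 1"
proof -
  have "a \<noteq> 0" using assms by auto
  moreover have "a ^ n = a * a ^ (n - 1)" using assms(2) by (cases n) auto
  ultimately show ?thesis by simp
qed

text \<open>Solving \<open>(- exp (\<i> t)) ^ (n - 1) = 1\<close> means \<open>exp (\<i> (n - 1) t) = (-1) ^ (n - 1)\<close>, and
  \<open>(n - 1) t\<close> runs through \<open>[0, 2\<pi>)\<close> exactly once as \<open>t\<close> runs through the angles of the sector.\<close>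

definition parabolic_angle :: "nat \<Rightarrow> real" where
  "parabolic_angle n = Arg2pi ((-1) ^ (n - 1)) / (real n - 1)"

definition parabolic_param :: "nat \<Rightarrow> complex" where
  "parabolic_param n = of_real (critical_radius n) * exp (\<i> * of_real (parabolic_angle n))"

definition parabolic_fixpoint :: "nat \<Rightarrow> complex" where
  "parabolic_fixpoint n = - exp (\<i> * of_real (parabolic_angle n))"

lemma norm_parabolic_fixpoint: "norm (parabolic_fixpoint n) = 1" by (simp add: parabolic_fixpoint_def)

lemma parabolic_param_eq: "parabolic_param n = - of_real (critical_radius n) * parabolic_fixpoint n" by (simp add: parabolic_param_def parabolic_fixpoint_def)

lemma norm_parabolic_param: "n \<ge> 2 \<Longrightarrow> norm (parabolic_param n) = critical_radius n"
  using critical_radius_bounds[of n] by (simp add: parabolic_param_def norm_mult)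

lemma power_exp_angle:
  assumes "n \<ge> 2"
  shows "(- exp (\<i> * of_real t)) ^ (n - 1) = (-1) ^ (n - 1) * exp (\<i> * of_real ((real n - 1) * t))"
proof -
  have "(- exp (\<i> * of_real t)) ^ (n - 1) = (-1) ^ (n - 1) * exp (of_nat (n - 1) * (\<i> * of_real t))"
    by (subst power_minus) (simp only: exp_of_nat_mult)
  moreover have "of_nat (n - 1) * (\<i> * of_real t) = \<i> * complex_of_real ((real n - 1) * t)"
    using assms by (simp add: of_nat_diff mult_ac)
  ultimately show ?thesis by (simp only:)
qed

lemma power_exp_angle_eq_1_iff:
  assumes n: "n \<ge> 2" and t: "0 \<le> t" "t < 2 * pi / (real n - 1)"
  shows "(- exp (\<i> * of_real t)) ^ (n - 1) = 1 \<longleftrightarrow> t = parabolic_angle n"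
proof -
  let ?s = "(-1 :: complex) ^ (n - 1)"
  have n1: "real n - 1 > 0" using n by simp
  have ss: "?s * ?s = 1" by (simp add: power_mult_distrib[symmetric])
  have s1: "norm ?s = 1" by (simp add: norm_power)
  have "(- exp (\<i> * of_real t)) ^ (n - 1) = 1 \<longleftrightarrow> exp (\<i> * of_real ((real n - 1) * t)) = ?s"
    unfolding power_exp_angle[OF n]
  proof
    assume "?s * exp (\<i> * of_real ((real n - 1) * t)) = 1"
    then have "?s * (?s * exp (\<i> * of_real ((real n - 1) * t))) = ?s" by (simp only: mult_1_right)
    then show "exp (\<i> * of_real ((real n - 1) * t)) = ?s" by (simp only: mult.assoc[symmetric] ss mult_1_left)
  qed (simp only: ss)
  also have "\<dots> \<longleftrightarrow> Arg2pi ?s = (real n - 1) * t"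
  proof
    assume "exp (\<i> * of_real ((real n - 1) * t)) = ?s"
    then show "Arg2pi ?s = (real n - 1) * t"
      using t n1 by (intro Arg2pi_unique[of 1] mult_nonneg_nonneg) (simp_all add: pos_less_divide_eq mult.commute)
  next
    assume "Arg2pi ?s = (real n - 1) * t"
    then show "exp (\<i> * of_real ((real n - 1) * t)) = ?s"
      using s1 complex_norm_eq_1_exp by metis
  qed
  also have "\<dots> \<longleftrightarrow> t = parabolic_angle n" unfolding parabolic_angle_def using n1 by (auto simp: field_simps)
  finally show ?thesis .
qed

lemma parabolic_angle_bounds:
  assumes "n \<ge> 2"
  shows "0 \<le> parabolic_angle n" "parabolic_angle n < 2 * pi / (real n - 1)"
  using assms Arg2pi_ge_0[of "(-1) ^ (n - 1)"] Arg2pi_lt_2pi[of "(-1) ^ (n - 1)"]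
  unfolding parabolic_angle_def by (simp, intro divide_strict_right_mono) simp_all

lemma sector_norm: "w \<in> sector n \<Longrightarrow> norm w < 1" by (simp add: sector_def)

lemma parabolic_param_in_sector:
  assumes n: "n \<ge> 2"
  shows "parabolic_param n \<in> sector n"
proof -
  have "2 * pi / (real n - 1) \<le> 2 * pi" using n by (simp add: divide_simps)
  then have "Arg2pi (parabolic_param n) = parabolic_angle n"
    using parabolic_angle_bounds[OF n] critical_radius_bounds[OF n]
    by (intro Arg2pi_unique[of "critical_radius n"]) (auto simp: parabolic_param_def)
  then show ?thesis
    unfolding sector_def using parabolic_angle_bounds[OF n] norm_parabolic_param[OF n] critical_radius_bounds[OF n] by simp
qed

lemma parabolic_fixpoint_fixed:
  assumes n: "n \<ge> 2"
  shows "blaschke n (parabolic_param n) (parabolic_fixpoint n) = parabolic_fixpoint n" "dilation n (parabolic_param n) (parabolic_fixpoint n) = 1"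
proof -
  have c: "0 < critical_radius n" "critical_radius n < 1" using critical_radius_bounds[OF n] by auto
  have "parabolic_fixpoint n ^ (n - 1) = 1"
    unfolding parabolic_fixpoint_def using power_exp_angle_eq_1_iff[OF n parabolic_angle_bounds[OF n]] by simp
  then show "blaschke n (parabolic_param n) (parabolic_fixpoint n) = parabolic_fixpoint n"
    unfolding parabolic_param_eq using blaschke_antipodal[OF norm_parabolic_fixpoint, of "critical_radius n" n n]
      power_eq_self_iff[OF norm_parabolic_fixpoint, of n n] c n by simp
  have "cnj (parabolic_fixpoint n) * parabolic_fixpoint n = 1"
    using norm_parabolic_fixpoint[of n] complex_norm_square[of "parabolic_fixpoint n"] by (simp add: mult.commute)
  then have "1 - cnj (parabolic_param n) * parabolic_fixpoint n = of_real (1 + critical_radius n)"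
    unfolding parabolic_param_eq by (simp add: mult.assoc)
  then have "norm (1 - cnj (parabolic_param n) * parabolic_fixpoint n) = 1 + critical_radius n" using c by (simp del: of_real_add)
  then show "dilation n (parabolic_param n) (parabolic_fixpoint n) = 1"
    using c norm_parabolic_param[OF n] critical_radius_identity[OF n]
      dilation_on_circle[OF _ norm_parabolic_fixpoint, of "parabolic_param n" n n] by simp
qed

lemma sector_antipodal_fixed_unique:
  assumes n: "n \<ge> 2" and w: "w \<in> sector n" and a: "norm a = 1" and wa: "w = - of_real (critical_radius n) * a"
    and fix_a: "blaschke n w a = a"
  shows "w = parabolic_param n"
proof -
  have c: "0 < critical_radius n" "critical_radius n < 1" using critical_radius_bounds[OF n] by auto
  have nw: "norm w = critical_radius n" unfolding wa using a c by (simp add: norm_mult)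
  have "a ^ (n - 1) = 1"
    using blaschke_antipodal[OF a, of "critical_radius n" n] power_eq_self_iff[OF a, of n] fix_a c n
    unfolding wa by simp
  moreover have w_exp: "w = of_real (critical_radius n) * exp (\<i> * of_real (Arg2pi w))"
    using Arg2pi_eq[of w] nw by simp
  then have "a = - exp (\<i> * of_real (Arg2pi w))"
  proof -
    have "of_real (critical_radius n) * a = of_real (critical_radius n) * - exp (\<i> * of_real (Arg2pi w))"
      using w_exp wa by simp
    then show ?thesis
      using c(1) mult_left_cancel[of "complex_of_real (critical_radius n)"] by (metis less_irrefl of_real_eq_0_iff)
  qed
  ultimately have "Arg2pi w = parabolic_angle n"
    using power_exp_angle_eq_1_iff[OF n, of "Arg2pi w"] w unfolding sector_def by simp
  then show ?thesis using w_exp unfolding parabolic_param_def by simp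
qed

lemma parabolic_param_not_elliptic:
  assumes n: "n \<ge> 2"
  shows "parabolic_param n \<notin> elliptic_locus n"
proof -
  have "\<not> elliptic (blaschke n (parabolic_param n))"
    unfolding not_elliptic_iff[OF sector_norm[OF parabolic_param_in_sector[OF n]] n]
    using norm_parabolic_fixpoint[of n] parabolic_fixpoint_fixed[OF n] by (intro exI[of _ "parabolic_fixpoint n"]) simp
  then show ?thesis by (simp add: elliptic_locus_def)
qed

lemma critical_circle_elliptic:
  assumes n: "n \<ge> 2" and w: "w \<in> sector n" "norm w = critical_radius n" "w \<noteq> parabolic_param n"
  shows "elliptic (blaschke n w)"
proof (rule ccontr)
  assume "\<not> ?thesis"
  then obtain a where a: "norm a = 1" "blaschke n w a = a" "dilation n w a \<le> 1"
    using not_elliptic_iff[OF sector_norm[OF w(1)] n] by blast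
  have "w = - of_real (critical_radius n) * a"
    using dilation_le_1_critical_norm[OF sector_norm[OF w(1)] a(1,3) n] w(2) by (simp add: critical_radius_def)
  then show False using sector_antipodal_fixed_unique[OF n w(1) a(1) _ a(2)] w(3) by simp
qed

lemma small_elliptic:
  assumes "n \<ge> 2" "norm w < critical_radius n"
  shows "elliptic (blaschke n w)"
proof -
  have w: "norm w < 1" using assms critical_radius_bounds[of n] by simp
  show ?thesis
    using not_elliptic_iff[OF w assms(1)] dilation_le_1_imp_norm_ge[OF w, of _ n] assms(2)
    unfolding critical_radius_def by (meson not_less)
qed

lemma sector_scaled:
  assumes "w \<in> sector n" "0 < t" "t \<le> 1"
  shows "of_real t * w \<in> sector n"
proof -
  have "norm (of_real t * w) \<le> 1 * norm w"
    unfolding norm_mult using assms(2,3) by (intro mult_right_mono) auto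
  moreover have "Arg2pi (of_real t * w) = Arg2pi w" using assms(2) by simp
  ultimately show ?thesis using assms(1) unfolding sector_def by simp
qed

text \<open>The special parameter is a limit of the elliptic parameters \<open>t w\<close> with \<open>t < 1\<close> without being
  elliptic itself, and every other point of the sector on the critical circle is elliptic, hence interior.\<close>

theorem frontier_elliptic_locus_critical:
  assumes n: "n \<ge> 2"
  shows "(top_of_set (sector n) frontier_of elliptic_locus n) \<inter> {w. norm w = critical_radius n} = {parabolic_param n}"
proof (intro equalityI subsetI)
  fix w assume "w \<in> (top_of_set (sector n) frontier_of elliptic_locus n) \<inter> {w. norm w = critical_radius n}"
  then have wf: "w \<in> top_of_set (sector n) frontier_of elliptic_locus n" and wn: "norm w = critical_radius n" by auto
  have ws: "w \<in> sector n" using wf frontier_of_subset_topspace by fastforce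
  have "w = parabolic_param n"
  proof (rule ccontr)
    assume "w \<noteq> parabolic_param n"
    then have "elliptic (blaschke n w)" by (rule critical_circle_elliptic[OF n ws wn])
    then obtain e where e: "e > 0" "\<And>w'. norm w' < 1 \<Longrightarrow> dist w' w < e \<Longrightarrow> elliptic (blaschke n w')"
      using elliptic_open[OF sector_norm[OF ws] n] by blast
    have "openin (top_of_set (sector n)) (sector n \<inter> ball w e)" by (simp add: openin_open_Int)
    moreover have "sector n \<inter> ball w e \<subseteq> elliptic_locus n"
      unfolding elliptic_locus_def using e(2) sector_norm by (auto simp: dist_commute)
    ultimately have "sector n \<inter> ball w e \<subseteq> top_of_set (sector n) interior_of elliptic_locus n"
      by (intro interior_of_maximal)
    moreover have "w \<in> sector n \<inter> ball w e" using ws e(1) by simp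
    ultimately have "w \<in> top_of_set (sector n) interior_of elliptic_locus n" by (rule subsetD)
    then show False using wf unfolding frontier_of_def by simp
  qed
  then show "w \<in> {parabolic_param n}" by simp
next
  fix w assume "w \<in> {parabolic_param n}"
  then have w: "w = parabolic_param n" by simp
  have ws: "w \<in> sector n" using parabolic_param_in_sector[OF n] w by simp
  have c: "0 < critical_radius n" "critical_radius n < 1" using critical_radius_bounds[OF n] by auto
  have wn: "norm w = critical_radius n" using norm_parabolic_param[OF n] w by simp
  have "w \<notin> top_of_set (sector n) interior_of elliptic_locus n"
    using parabolic_param_not_elliptic[OF n] interior_of_subset w by fastforce
  moreover have "w \<in> top_of_set (sector n) closure_of elliptic_locus n"
    unfolding in_closure_of
  proof (intro conjI allI impI)
    show "w \<in> topspace (top_of_set (sector n))" using ws by simp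
    fix T assume T: "w \<in> T \<and> openin (top_of_set (sector n)) T"
    then obtain e where e: "e > 0" "\<And>x. x \<in> sector n \<Longrightarrow> dist x w < e \<Longrightarrow> x \<in> T"
      unfolding openin_euclidean_subtopology_iff by blast
    define t where "t = 1 - min (e / 2) (1 / 2)"
    have t: "0 < t" "t < 1" "1 - t < e" using e(1) by (auto simp: t_def)
    define x where "x = of_real t * w"
    have xs: "x \<in> sector n" unfolding x_def using sector_scaled[OF ws] t by simp
    have "x - w = - of_real (1 - t) * w" unfolding x_def by (simp add: algebra_simps)
    then have "dist x w = (1 - t) * norm w" unfolding dist_norm using t by (simp add: norm_mult del: of_real_diff)
    also have "\<dots> \<le> (1 - t) * 1" using t wn c by (intro mult_left_mono) auto
    finally have "x \<in> T" using e(2)[OF xs] t by simp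
    moreover have "norm x < critical_radius n" unfolding x_def norm_mult wn using t c by simp
    then have "x \<in> elliptic_locus n" unfolding elliptic_locus_def using small_elliptic[OF n] xs by simp
    ultimately show "\<exists>y. y \<in> elliptic_locus n \<and> y \<in> T" by blast
  qed
  ultimately show "w \<in> (top_of_set (sector n) frontier_of elliptic_locus n) \<inter> {w. norm w = critical_radius n}"
    unfolding frontier_of_def using wn by simp
qed

section \<open>The chordal metric and the Fatou set\<close>

lemma not_in_julia_set_iff:
  "p \<notin> julia_set f \<longleftrightarrow> (\<exists>U. open U \<and> p \<in> U \<and> normal_family_on U {f ^^ k | k. k \<ge> 1})"
  by (auto simp: julia_set_def)

lemma normal_family_onE:
  assumes "normal_family_on U Fs" "range f \<subseteq> Fs"
  obtains r g where "strict_mono (r :: nat \<Rightarrow> nat)"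
    "\<And>K. compact K \<Longrightarrow> K \<subseteq> U \<Longrightarrow> uniform_limit K (\<lambda>i. f (r i)) g sequentially"
proof -
  obtain r g where "strict_mono (r :: nat \<Rightarrow> nat)"
    and "\<forall>K. compact K \<and> K \<subseteq> U \<longrightarrow> uniform_limit K (\<lambda>i. f (r i)) g sequentially"
    using assms(1)[unfolded normal_family_on_def, rule_format, OF assms(2)] by (elim exE conjE)
  then show thesis by (intro that) auto
qed

lemma dist_Fin:
  "dist (Fin z) (Fin u) = 2 * norm (z - u) / (sqrt (1 + (norm z)\<^sup>2) * sqrt (1 + (norm u)\<^sup>2))"
proof -
  define a b where "a = 1 + (norm z)\<^sup>2" and "b = 1 + (norm u)\<^sup>2"
  have pos: "a > 0" "b > 0" unfolding a_def b_def by (smt (verit) zero_le_power2)+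
  obtain x y p q where zu: "z = Complex x y" "u = Complex p q" by (metis complex_surj)
  have ab: "a = 1 + x\<^sup>2 + y\<^sup>2" "b = 1 + p\<^sup>2 + q\<^sup>2" unfolding a_def b_def zu by (simp_all add: cmod_power2)
  have "dist (Fin z) (Fin u) =
      sqrt ((norm ((2 / a) *\<^sub>R z - (2 / b) *\<^sub>R u))\<^sup>2 + ((1 - 2 / a) - (1 - 2 / b))\<^sup>2)"
    using stereo_Fin_snd[of z] stereo_Fin_snd[of u]
    by (simp add: dist_riemann_sphere_def dist_prod_def dist_norm a_def b_def)
  also have "(norm ((2 / a) *\<^sub>R z - (2 / b) *\<^sub>R u))\<^sup>2 = (2 * x / a - 2 * p / b)\<^sup>2 + (2 * y / a - 2 * q / b)\<^sup>2"
    unfolding cmod_power2 zu by simp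
  also have "\<dots> + ((1 - 2 / a) - (1 - 2 / b))\<^sup>2
      = 4 * ((1 + x\<^sup>2 + y\<^sup>2) / a\<^sup>2 + (1 + p\<^sup>2 + q\<^sup>2) / b\<^sup>2 - 2 * (x * p + y * q + 1) / (a * b))"
    using pos by (simp add: divide_simps power2_eq_square) algebra
  also have "\<dots> = 4 * (1 / a + 1 / b - 2 * (x * p + y * q + 1) / (a * b))"
    unfolding ab[symmetric] using pos by (simp add: power2_eq_square)
  also have "\<dots> = (2 * norm (z - u))\<^sup>2 / (a * b)"
  proof -
    have "(norm (z - u))\<^sup>2 = a + b - 2 * (x * p + y * q + 1)"
      unfolding cmod_power2 zu ab by (simp add: power2_eq_square algebra_simps)
    then show ?thesis using pos by (simp add: power_mult_distrib divide_simps)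
  qed
  also have "sqrt \<dots> = 2 * norm (z - u) / (sqrt a * sqrt b)"
    by (simp add: real_sqrt_divide real_sqrt_mult)
  finally show ?thesis unfolding a_def b_def .
qed

lemma dist_Fin_Infty: "dist (Fin z) Infty = 2 / sqrt (1 + (norm z)\<^sup>2)"
proof -
  define a where "a = 1 + (norm z)\<^sup>2"
  have pos: "a > 0" unfolding a_def by (smt (verit) zero_le_power2)
  have "dist (Fin z) Infty = sqrt ((norm ((2 / a) *\<^sub>R z))\<^sup>2 + ((1 - 2 / a) - 1)\<^sup>2)"
    using stereo_Fin_snd[of z]
    by (simp add: dist_riemann_sphere_def dist_prod_def dist_norm a_def)
  also have "(norm ((2 / a) *\<^sub>R z))\<^sup>2 = 4 * (a - 1) / a\<^sup>2"
    unfolding norm_scaleR power_mult_distrib by (simp add: a_def power_divide)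
  also have "\<dots> + ((1 - 2 / a) - 1)\<^sup>2 = 2\<^sup>2 / a"
    using pos by (simp add: divide_simps power2_eq_square; algebra?)
  also have "sqrt \<dots> = 2 / sqrt a" by (simp add: real_sqrt_divide)
  finally show ?thesis unfolding a_def .
qed

lemma dist_Fin_le: "dist (Fin z) (Fin u) \<le> 2 * norm (z - u)"
proof -
  have "1 * 1 \<le> sqrt (1 + (norm z)\<^sup>2) * sqrt (1 + (norm u)\<^sup>2)" by (intro mult_mono) auto
  then show ?thesis unfolding dist_Fin by (simp add: divide_le_eq mult_left_le mult_le_cancel_left1)
qed

text \<open>Together with \<open>dist_Fin_le\<close> this makes the chordal and the Euclidean metric equivalent on the closed unit
  disc.\<close>

lemma norm_diff_le_dist_Fin:
  assumes "norm z \<le> 1" "norm u \<le> 1"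
  shows "norm (z - u) \<le> dist (Fin z) (Fin u)"
proof -
  have "sqrt (1 + (norm z)\<^sup>2) * sqrt (1 + (norm u)\<^sup>2) \<le> sqrt 2 * sqrt 2"
    using assms by (intro mult_mono real_sqrt_le_mono) (auto simp: abs_square_le_1)
  then have le: "sqrt (1 + (norm z)\<^sup>2) * sqrt (1 + (norm u)\<^sup>2) \<le> 2" by simp
  have "0 < sqrt (1 + (norm z)\<^sup>2) * sqrt (1 + (norm u)\<^sup>2)"
    by (intro mult_pos_pos) (auto simp: add_pos_nonneg)
  moreover have "norm (z - u) * (sqrt (1 + (norm z)\<^sup>2) * sqrt (1 + (norm u)\<^sup>2)) \<le> norm (z - u) * 2"
    using le by (rule mult_left_mono) simp
  ultimately show ?thesis unfolding dist_Fin by (simp add: pos_le_divide_eq mult.commute)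
qed

lemma continuous_on_Fin: "continuous_on S Fin"
  unfolding continuous_on_iff
proof (intro ballI allI impI)
  fix z :: complex and e :: real assume "e > 0"
  have "dist (Fin z') (Fin z) < e" if "dist z' z < e / 2" for z'
    using dist_Fin_le[of z' z] that by (simp add: dist_norm)
  then show "\<exists>d>0. \<forall>z'\<in>S. dist z' z < d \<longrightarrow> dist (Fin z') (Fin z) < e"
    using \<open>e > 0\<close> by (intro exI[of _ "e / 2"]) simp
qed

lemma open_Fin_image:
  assumes "open V"
  shows "open (Fin ` V)"
  unfolding open_dist
proof
  fix p assume "p \<in> Fin ` V"
  then obtain z where z: "z \<in> V" "p = Fin z" by blast
  obtain d where d: "d > 0" "ball z d \<subseteq> V" using assms z(1) open_contains_ball by blast
  define c where "c = sqrt (1 + (norm z)\<^sup>2)"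
  have c: "c > 0" unfolding c_def by (simp add: add_pos_nonneg)
  define e where "e = min (1 / c) (d / (c * (1 + norm z)))"
  have nz: "1 + norm z > 0" by (smt (verit) norm_ge_zero)
  have e: "e > 0" unfolding e_def using c d nz by simp
  have ec: "e * c \<le> 1" unfolding e_def using c by (simp add: min_def field_simps)
  have ed: "e * c * (1 + norm z) \<le> d"
  proof -
    have "e * (c * (1 + norm z)) \<le> d / (c * (1 + norm z)) * (c * (1 + norm z))"
      unfolding e_def using c nz by (intro mult_right_mono) auto
    then show ?thesis using c nz by (simp add: mult.assoc)
  qed
  have "q \<in> Fin ` V" if q: "dist q p < e" for q
  proof (cases q)
    case Infty
    have "2 / c < e" using q unfolding Infty z(2) dist_commute[of Infty] dist_Fin_Infty c_def .
    then show ?thesis using ec c by (simp add: divide_simps)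
  next
    case (Fin u)
    define s where "s = sqrt (1 + (norm u)\<^sup>2)"
    have s: "s > 0" unfolding s_def by (simp add: add_pos_nonneg)
    have "s \<le> 1 + norm u" unfolding s_def by (rule real_le_lsqrt) (auto simp: power2_eq_square algebra_simps)
    also have "norm u \<le> norm z + norm (u - z)" using norm_triangle_sub[of u z] by simp
    finally have s_le: "s \<le> 1 + norm z + norm (u - z)" by simp
    have "2 * norm (u - z) / (s * c) < e" using q unfolding Fin z(2) dist_Fin s_def c_def .
    then have "2 * norm (u - z) < e * c * s" using s c by (simp add: pos_divide_less_eq mult_ac)
    also have "\<dots> \<le> e * c * (1 + norm z + norm (u - z))" using s_le e c by (intro mult_left_mono) auto
    also have "\<dots> = e * c * (1 + norm z) + e * c * norm (u - z)" by (simp add: algebra_simps)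
    also have "\<dots> \<le> d + 1 * norm (u - z)" using ed ec by (intro add_mono mult_right_mono) auto
    finally have "norm (u - z) < d" by simp
    then have "u \<in> ball z d" unfolding mem_ball dist_norm by (subst norm_minus_commute)
    then have "u \<in> V" by (rule subsetD[OF d(2)])
    then show ?thesis unfolding Fin by (rule imageI)
  qed
  then show "\<exists>e>0. \<forall>y. dist y p < e \<longrightarrow> y \<in> Fin ` V" by (intro exI[of _ e] conjI e allI impI)
qed

lemma compact_Fin_vimage:
  assumes "compact K" "K \<subseteq> Fin ` V" "bounded V"
  shows "compact (Fin -` K)"
proof -
  have "closed (Fin -` K)"
    by (rule closed_vimage[OF compact_imp_closed[OF assms(1)] continuous_on_Fin])
  moreover have "Fin -` K \<subseteq> V" using assms(2) by auto
  ultimately show ?thesis using bounded_subset[OF assms(3)] by (simp add: compact_eq_bounded_closed)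
qed

lemma blaschke_sphere_funpow:
  assumes "\<And>z. z \<in> V \<Longrightarrow> 1 - cnj w * z \<noteq> 0" "\<And>z. z \<in> V \<Longrightarrow> blaschke n w z \<in> V" "z \<in> V"
  shows "(blaschke_sphere n w ^^ k) (Fin z) = Fin ((blaschke n w ^^ k) z) \<and> (blaschke n w ^^ k) z \<in> V"
proof (induction k)
  case 0
  show ?case using assms(3) by simp
next
  case (Suc k)
  then have V: "(blaschke n w ^^ k) z \<in> V" by simp
  show ?case using Suc assms(1)[OF V] assms(2)[OF V] by simp
qed

lemma holomorphic_blaschke_funpow:
  assumes "\<And>z. z \<in> V \<Longrightarrow> 1 - cnj w * z \<noteq> 0" "\<And>z. z \<in> V \<Longrightarrow> blaschke n w z \<in> V"
  shows "(blaschke n w ^^ k) holomorphic_on V"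
proof (induction k)
  case 0
  show ?case by (simp add: id_def)
next
  case (Suc k)
  have "blaschke n w holomorphic_on V"
    unfolding blaschke_def using assms(1) by (intro holomorphic_intros) auto
  moreover have "(blaschke n w ^^ k) ` V \<subseteq> V"
    using blaschke_sphere_funpow[of V w n, OF assms] by auto
  ultimately show ?case
    using holomorphic_on_compose_gen[OF Suc] by (simp add: o_def)
qed

text \<open>Montel's theorem in the plane, transported to the sphere: on a bounded invariant set the iterates are
  uniformly bounded holomorphic functions, and the embedding of the plane is Lipschitz.\<close>

theorem bounded_invariant_disjoint_julia:
  assumes "open V" "bounded V" "\<And>z. z \<in> V \<Longrightarrow> 1 - cnj w * z \<noteq> 0"
    and "\<And>z. z \<in> V \<Longrightarrow> blaschke n w z \<in> V" and "z \<in> V"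
  shows "Fin z \<notin> julia_set (blaschke_sphere n w)"
proof -
  let ?F = "blaschke_sphere n w" and ?b = "blaschke n w"
  have it: "(?F ^^ k) (Fin z) = Fin ((?b ^^ k) z)" "(?b ^^ k) z \<in> V" if "z \<in> V" for k z
    using blaschke_sphere_funpow[of V w n z k, OF assms(3,4) that] by blast+
  have "normal_family_on (Fin ` V) {?F ^^ k | k. k \<ge> 1}"
    unfolding normal_family_on_def
  proof (intro allI impI)
    fix f :: "nat \<Rightarrow> riemann_sphere \<Rightarrow> riemann_sphere"
    assume "range f \<subseteq> {?F ^^ k | k. k \<ge> 1}"
    then have "\<exists>k. f i = ?F ^^ k" for i by blast
    then obtain m where m: "\<And>i. f i = ?F ^^ m i" by metis
    obtain g r where r: "strict_mono (r :: nat \<Rightarrow> nat)"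
      and g: "\<And>K. compact K \<Longrightarrow> K \<subseteq> V \<Longrightarrow> uniform_limit K ((\<lambda>i. ?b ^^ m i) \<circ> r) g sequentially"
    proof (rule Montel[of V "range (\<lambda>k. ?b ^^ k)" "\<lambda>i. ?b ^^ m i"])
      fix h assume "h \<in> range (\<lambda>k. ?b ^^ k)"
      then obtain k where "h = ?b ^^ k" by blast
      then show "h holomorphic_on V" using holomorphic_blaschke_funpow[of V w n k, OF assms(3,4)] by simp
    next
      fix K assume "K \<subseteq> V"
      obtain B where "\<And>x. x \<in> V \<Longrightarrow> norm x \<le> B" using assms(2) unfolding bounded_iff by blast
      then show "\<exists>B. \<forall>h\<in>range (\<lambda>k. ?b ^^ k). \<forall>z\<in>K. norm (h z) \<le> B"
        using it(2) \<open>K \<subseteq> V\<close> by blast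
    qed (use assms(1) in auto)
    define G where "G = (\<lambda>p. case p of Fin z \<Rightarrow> Fin (g z) | Infty \<Rightarrow> Infty)"
    have "uniform_limit K (\<lambda>i. f (r i)) G sequentially" if K: "compact K" "K \<subseteq> Fin ` V" for K
      unfolding uniform_limit_iff
    proof (intro allI impI)
      fix e :: real assume "e > 0"
      have "Fin -` K \<subseteq> V" using K(2) by auto
      then have "\<forall>\<^sub>F i in sequentially. \<forall>x\<in>Fin -` K. dist (((\<lambda>i. ?b ^^ m i) \<circ> r) i x) (g x) < e / 2"
        using \<open>e > 0\<close> by (intro uniform_limitD[OF g[OF compact_Fin_vimage[OF K assms(2)]]]) auto
      then show "\<forall>\<^sub>F i in sequentially. \<forall>x\<in>K. dist (f (r i) x) (G x) < e"
      proof eventually_elim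
        case (elim i)
        show ?case
        proof
          fix x assume x: "x \<in> K"
          then obtain z where z: "z \<in> V" "x = Fin z" using K(2) by blast
          have "norm ((?b ^^ m (r i)) z - g z) < e / 2" using elim x z(2) by (simp add: dist_norm)
          then show "dist (f (r i) x) (G x) < e"
            using dist_Fin_le[of "(?b ^^ m (r i)) z" "g z"] by (simp add: m z it(1) G_def)
        qed
      qed
    qed
    then show "\<exists>r g. strict_mono r \<and>
        (\<forall>K. compact K \<and> K \<subseteq> Fin ` V \<longrightarrow> uniform_limit K (\<lambda>i. f (r i)) g sequentially)"
      using r by blast
  qed
  then show ?thesis
    unfolding not_in_julia_set_iff
    by (intro exI[of _ "Fin ` V"] conjI open_Fin_image[OF assms(1)] imageI[OF \<open>z \<in> V\<close>])
qed

lemma disc_disjoint_julia: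
  assumes "norm w < 1" "n \<ge> 1" "norm z < 1"
  shows "Fin z \<notin> julia_set (blaschke_sphere n w)"
proof (rule bounded_invariant_disjoint_julia[of "ball 0 1"])
  fix u :: complex assume "u \<in> ball 0 1"
  then have u: "norm u < 1" by simp
  show "1 - cnj w * u \<noteq> 0" by (rule mob_denom_nonzero[OF assms(1) less_imp_le[OF u]])
  show "blaschke n w u \<in> ball 0 1" using norm_blaschke_less_1[OF assms(1) u assms(2)] by simp
qed (use assms(3) in auto)

text \<open>Reflection in the unit circle. Stereographically it is the reflection in the equatorial plane, hence an
  isometry, and it commutes with a Blaschke product; this carries normality from the disc to the exterior.\<close>

fun refl_sphere :: "riemann_sphere \<Rightarrow> riemann_sphere" where
  "refl_sphere (Fin z) = (if z = 0 then Infty else Fin (1 / cnj z))"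
| "refl_sphere Infty = Fin 0"

lemma refl_sphere_invol [simp]: "refl_sphere (refl_sphere p) = p"
  by (cases p) auto

lemma stereo_refl_sphere: "stereo (refl_sphere p) = (fst (stereo p), - snd (stereo p))"
proof (cases p)
  case (Fin z)
  show ?thesis
  proof (cases "z = 0")
    case False
    define N where "N = (norm z)\<^sup>2"
    have N: "N > 0" using False by (simp add: N_def)
    have i: "1 / cnj z = (1 / N) *\<^sub>R z"
      using False complex_norm_square[of z]
      by (simp add: N_def divide_simps scaleR_conv_of_real)
    have n: "(norm (1 / cnj z))\<^sup>2 = 1 / N" by (simp add: N_def norm_divide power_divide)
    have "(2 / (1 + 1 / N)) *\<^sub>R ((1 / N) *\<^sub>R z) = (2 / (1 + N)) *\<^sub>R z"
      using N by (simp add: divide_simps add.commute)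
    moreover have "(1 / N - 1) / (1 / N + 1) = - ((N - 1) / (N + 1))"
      using N by (simp add: divide_simps)
    ultimately show ?thesis using Fin False n i by (simp add: N_def)
  qed (simp add: Fin)
qed simp

lemma dist_refl_sphere [simp]: "dist (refl_sphere p) (refl_sphere q) = dist p q"
  by (simp add: dist_riemann_sphere_def stereo_refl_sphere dist_prod_def dist_norm abs_minus_commute power2_commute)

lemma continuous_on_refl_sphere: "continuous_on S refl_sphere"
  unfolding continuous_on_iff by auto

lemma blaschke_sphere_refl:
  assumes w: "norm w < 1" and n: "n \<ge> 1"
  shows "blaschke_sphere n w (refl_sphere p) = refl_sphere (blaschke_sphere n w p)"
proof (cases p)
  case Infty
  have "1 / (- (1 / w)) ^ n = (- w) ^ n" if "w \<noteq> 0"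
    using power_one_over[of "- (1 / w)" n] that by simp
  then show ?thesis using Infty n by (auto simp: blaschke_def)
next
  case (Fin z)
  have ww: "1 - cnj w * w \<noteq> 0" using mob_denom_nonzero[OF w, of w] w by simp
  consider "z = 0" | "z \<noteq> 0" "z = w" | "z \<noteq> 0" "z \<noteq> w" "1 - cnj w * z = 0"
    | "z \<noteq> 0" "z \<noteq> w" "1 - cnj w * z \<noteq> 0" by blast
  then show ?thesis
  proof cases
    case 1
    have "(- (1 / cnj w)) ^ n = 1 / (- cnj w) ^ n" if "w \<noteq> 0"
      using power_one_over[of "- cnj w" n] that by simp
    then show ?thesis using Fin n 1 by (auto simp: blaschke_def)
  next
    case 2
    then show ?thesis using Fin n ww by (simp add: blaschke_def)
  next
    case 3
    then have "cnj (cnj w * z) = 1" by simp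
    then have wz: "w * cnj z = 1" by simp
    then have "1 / cnj z = w" using 3 by (simp add: field_simps)
    then show ?thesis using Fin n ww 3 by (simp add: blaschke_def)
  next
    case 4
    have nz: "cnj z - cnj w \<noteq> 0" using 4(2) by (metis complex_cnj_cancel_iff right_minus_eq)
    have nz2: "1 - w * cnj z \<noteq> 0"
      using 4(3) by (metis complex_cnj_cnj complex_cnj_diff complex_cnj_mult complex_cnj_one complex_cnj_zero)
    have d: "1 - cnj w * (1 / cnj z) = (cnj z - cnj w) / cnj z" using 4(1) by (simp add: field_simps)
    have "(1 / cnj z - w) = (1 - w * cnj z) / cnj z" using 4(1) by (simp add: field_simps)
    then have "blaschke n w (1 / cnj z) = ((1 - w * cnj z) / (cnj z - cnj w)) ^ n"
      unfolding blaschke_def d using 4(1) by simp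
    also have "\<dots> = 1 / cnj (blaschke n w z)" by (simp add: blaschke_def power_divide)
    finally have b: "blaschke n w (1 / cnj z) = 1 / cnj (blaschke n w z)" .
    have "blaschke n w z \<noteq> 0" unfolding blaschke_def using 4 by simp
    moreover have "1 - cnj w * (1 / cnj z) \<noteq> 0" unfolding d using nz 4(1) by simp
    ultimately show ?thesis using Fin 4 b by simp
  qed
qed

lemma blaschke_sphere_funpow_refl:
  assumes "norm w < 1" "n \<ge> 1"
  shows "(blaschke_sphere n w ^^ k) (refl_sphere p) = refl_sphere ((blaschke_sphere n w ^^ k) p)"
  by (induction k) (simp_all add: blaschke_sphere_refl[OF assms])

lemma julia_set_refl:
  assumes "norm w < 1" "n \<ge> 1" "p \<notin> julia_set (blaschke_sphere n w)"
  shows "refl_sphere p \<notin> julia_set (blaschke_sphere n w)"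
proof -
  let ?Fs = "{blaschke_sphere n w ^^ k | k. k \<ge> 1}"
  obtain U where U: "open U" "p \<in> U" "normal_family_on U ?Fs"
    using assms(3) unfolding not_in_julia_set_iff by (elim exE conjE)
  have im: "refl_sphere ` U = refl_sphere -` U" by (force intro: image_eqI[of _ _ "refl_sphere _"])
  have op: "open (refl_sphere ` U)"
    unfolding im by (rule open_vimage[OF U(1) continuous_on_refl_sphere])
  have "normal_family_on (refl_sphere ` U) ?Fs"
    unfolding normal_family_on_def
  proof (intro allI impI)
    fix f :: "nat \<Rightarrow> riemann_sphere \<Rightarrow> riemann_sphere" assume f: "range f \<subseteq> ?Fs"
    obtain r g where r: "strict_mono (r :: nat \<Rightarrow> nat)"
      and g: "\<And>K. compact K \<Longrightarrow> K \<subseteq> U \<Longrightarrow> uniform_limit K (\<lambda>i. f (r i)) g sequentially"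
      using normal_family_onE[OF U(3) f] by blast
    have fr: "f i (refl_sphere x) = refl_sphere (f i x)" for i x
    proof -
      obtain k where "f i = blaschke_sphere n w ^^ k" using f by blast
      then show ?thesis using blaschke_sphere_funpow_refl[OF assms(1,2)] by simp
    qed
    have "uniform_limit K (\<lambda>i. f (r i)) (\<lambda>x. refl_sphere (g (refl_sphere x))) sequentially"
      if K: "compact K" "K \<subseteq> refl_sphere ` U" for K
    proof -
      have "compact (refl_sphere ` K)" by (rule compact_continuous_image[OF continuous_on_refl_sphere K(1)])
      moreover have "refl_sphere ` K \<subseteq> U" using K(2) by auto
      ultimately have ul: "uniform_limit (refl_sphere ` K) (\<lambda>i. f (r i)) g sequentially" by (rule g)
      have "dist (f i x) (refl_sphere (g (refl_sphere x))) = dist (f i (refl_sphere x)) (g (refl_sphere x))" for i x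
        using fr[of i "refl_sphere x"] by simp
      then show ?thesis using ul unfolding uniform_limit_iff by simp
    qed
    then show "\<exists>r g. strict_mono r \<and> (\<forall>K. compact K \<and> K \<subseteq> refl_sphere ` U \<longrightarrow>
        uniform_limit K (\<lambda>i. f (r i)) g sequentially)"
      using r by blast
  qed
  then show ?thesis
    unfolding not_in_julia_set_iff
    by (intro exI[of _ "refl_sphere ` U"] conjI op imageI[OF U(2)])
qed

lemma julia_set_subset_circle:
  assumes "norm w < 1" "n \<ge> 1"
  shows "julia_set (blaschke_sphere n w) \<subseteq> Fin ` sphere 0 1"
proof
  fix p assume p: "p \<in> julia_set (blaschke_sphere n w)"
  have refl_out: "refl_sphere (Fin u) \<notin> julia_set (blaschke_sphere n w)" if "norm u < 1" for u
    using julia_set_refl[OF assms disc_disjoint_julia[OF assms that]] .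
  show "p \<in> Fin ` sphere 0 1"
  proof (cases p)
    case Infty
    then show ?thesis using p refl_out[of 0] by simp
  next
    case (Fin z)
    have "\<not> norm z < 1" using disc_disjoint_julia[OF assms] p Fin by blast
    moreover have "\<not> norm z > 1"
    proof
      assume z: "norm z > 1"
      then have "z \<noteq> 0" by auto
      then have "refl_sphere (Fin (1 / cnj z)) = Fin z" by simp
      moreover have "norm (1 / cnj z) < 1"
        unfolding norm_divide complex_mod_cnj norm_one using z by (subst divide_less_eq_1) simp
      ultimately show False using refl_out[of "1 / cnj z"] p Fin by metis
    qed
    ultimately show ?thesis using Fin by simp
  qed
qed

section \<open>Circle points in the Julia set\<close>

lemma continuous_on_blaschke_funpow:
  assumes w: "norm w < 1" and n: "n \<ge> 1"
  shows "continuous_on (cball 0 1) (blaschke n w ^^ k) \<and> (blaschke n w ^^ k) ` cball 0 1 \<subseteq> cball 0 1"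
proof (induction k)
  case 0
  show ?case by (simp add: id_def)
next
  case (Suc k)
  have "continuous_on (cball 0 1) (blaschke n w \<circ> (blaschke n w ^^ k))"
    using Suc continuous_on_blaschke[OF w] by (intro continuous_on_compose) (auto intro: continuous_on_subset)
  then show ?case using Suc norm_blaschke_le_1[OF w _ n] by (auto simp: o_def)
qed

text \<open>At an interior point the limit function is forced to be the Denjoy--Wolff point \<open>a\<close>. The estimate
  extends to the circle because each single iterate is continuous on the closed disc.\<close>

lemma uniform_convergence_near_fatou_point:
  assumes w: "norm w < 1" and n: "n \<ge> 1" and a: "norm a \<le> 1"
    and conv: "\<And>z. norm z < 1 \<Longrightarrow> (\<lambda>k. (blaschke n w ^^ k) z) \<longlonglongrightarrow> a"
    and fatou: "Fin \<zeta> \<notin> julia_set (blaschke_sphere n w)"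
  obtains d where "d > 0"
    "\<And>e. e > 0 \<Longrightarrow> \<exists>k. \<forall>z \<in> ball \<zeta> d \<inter> cball 0 1. norm ((blaschke n w ^^ k) z - a) \<le> e"
proof -
  let ?F = "blaschke_sphere n w" and ?b = "blaschke n w"
  obtain U where U: "open U" "Fin \<zeta> \<in> U" "normal_family_on U {?F ^^ k | k. k \<ge> 1}"
    using fatou unfolding not_in_julia_set_iff by (elim exE conjE)
  have "range (\<lambda>i. ?F ^^ Suc i) \<subseteq> {?F ^^ k | k. k \<ge> 1}" by force
  from normal_family_onE[OF U(3) this]
  obtain r g where r: "strict_mono (r :: nat \<Rightarrow> nat)"
      and g: "\<And>K. compact K \<Longrightarrow> K \<subseteq> U \<Longrightarrow> uniform_limit K (\<lambda>i. ?F ^^ Suc (r i)) g sequentially"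
    by metis
  have it: "(?F ^^ k) (Fin z) = Fin ((?b ^^ k) z)" if "norm z \<le> 1" for k z
  proof (rule conjunct1[OF blaschke_sphere_funpow[of "cball 0 1"]])
    fix u :: complex assume "u \<in> cball 0 1"
    then have u: "norm u \<le> 1" by simp
    show "1 - cnj w * u \<noteq> 0" by (rule mob_denom_nonzero[OF w u])
    show "blaschke n w u \<in> cball 0 1" using norm_blaschke_le_1[OF w u n] by simp
  qed (use that in simp)
  have it1: "norm ((?b ^^ k) z) \<le> 1" if "norm z \<le> 1" for k z
  proof -
    have "(?b ^^ k) z \<in> cball 0 1" 
      using conjunct2[OF continuous_on_blaschke_funpow[OF w n, of k]] that
      unfolding image_subset_iff by (metis mem_cball_0)
    then show ?thesis by simp
  qed
  have "open (Fin -` U)" by (rule open_vimage[OF U(1) continuous_on_Fin])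
  then obtain d where d: "d > 0" "cball \<zeta> d \<subseteq> Fin -` U"
    using U(2) open_contains_cball by (metis vimageI)
  define K where "K = Fin ` (cball \<zeta> d \<inter> cball 0 1)"
  have "compact K" unfolding K_def by (intro compact_continuous_image continuous_on_Fin compact_Int) auto
  moreover have "K \<subseteq> U" unfolding K_def using d(2) by auto
  ultimately have ul: "uniform_limit K (\<lambda>i. ?F ^^ Suc (r i)) g sequentially" by (rule g)
  have ga: "g (Fin z) = Fin a" if z: "norm z < 1" "z \<in> cball \<zeta> d" for z
  proof -
    have "(\<lambda>i. (?F ^^ Suc (r i)) (Fin z)) \<longlonglongrightarrow> g (Fin z)"
      using tendsto_uniform_limitI[OF ul] z unfolding K_def by simp
    then have l1: "(\<lambda>i. Fin ((?b ^^ Suc (r i)) z)) \<longlonglongrightarrow> g (Fin z)"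
      using it[OF less_imp_le[OF z(1)]] by (simp del: funpow.simps)
    have "strict_mono (\<lambda>i. Suc (r i))" using r by (simp add: strict_mono_def)
    then have "(\<lambda>i. (?b ^^ Suc (r i)) z) \<longlonglongrightarrow> a"
      using LIMSEQ_subseq_LIMSEQ[OF conv[OF z(1)]] unfolding o_def by blast
    then have "(\<lambda>i. Fin ((?b ^^ Suc (r i)) z)) \<longlonglongrightarrow> Fin a"
      using continuous_on_tendsto_compose[OF continuous_on_Fin[of UNIV]] by simp
    then show ?thesis using LIMSEQ_unique[OF l1] by simp
  qed
  have "\<exists>k. \<forall>z \<in> ball \<zeta> d \<inter> cball 0 1. norm ((?b ^^ k) z - a) \<le> e" if "e > 0" for e
  proof -
    obtain i where i: "\<And>x. x \<in> K \<Longrightarrow> dist ((?F ^^ Suc (r i)) x) (g x) < e"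
      using ul \<open>e > 0\<close> unfolding uniform_limit_iff eventually_sequentially by (metis order_refl)
    define k where "k = Suc (r i)"
    have inner: "norm ((?b ^^ k) z - a) \<le> e" if z: "norm z < 1" "z \<in> ball \<zeta> d" for z
    proof -
      have "dist (Fin ((?b ^^ k) z)) (Fin a) < e"
        using i[of "Fin z"] z ga[of z] it[of z k] unfolding K_def k_def by (simp del: funpow.simps)
      then show ?thesis
        using norm_diff_le_dist_Fin[OF it1[of z k] a] z(1) by simp
    qed
    have "norm ((?b ^^ k) z - a) \<le> e" if z: "norm z \<le> 1" "z \<in> ball \<zeta> d" for z
    proof -
      define s where "s = (\<lambda>m. (1 - inverse (real (Suc m))) *\<^sub>R z)"
      have s: "s \<longlonglongrightarrow> z"
        unfolding s_def
        using tendsto_scaleR[OF tendsto_diff[OF tendsto_const LIMSEQ_inverse_real_of_nat, of 1] tendsto_const, of z]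
        by simp
      have s1: "norm (s m) < 1" for m
      proof -
        have c: "0 \<le> 1 - inverse (real (Suc m))" "1 - inverse (real (Suc m)) < 1" by (auto simp: field_simps)
        have "norm (s m) \<le> (1 - inverse (real (Suc m))) * 1"
          unfolding s_def norm_scaleR using c z(1) by (intro mult_mono) auto
        then show ?thesis using le_less_trans[OF _ c(2)] by simp
      qed
      have "(\<lambda>m. (?b ^^ k) (s m)) \<longlonglongrightarrow> (?b ^^ k) z"
        using continuous_on_blaschke_funpow[OF w n, of k] z(1) s1
        by (intro continuous_on_tendsto_compose[OF _ s]) (auto simp: less_imp_le)
      then have "(\<lambda>m. norm ((?b ^^ k) (s m) - a)) \<longlonglongrightarrow> norm ((?b ^^ k) z - a)"
        by (intro tendsto_intros)
      moreover have "\<forall>\<^sub>F m in sequentially. s m \<in> ball \<zeta> d"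
        using topological_tendstoD[OF s, of "ball \<zeta> d"] z(2) by simp
      then have "\<forall>\<^sub>F m in sequentially. norm ((?b ^^ k) (s m) - a) \<le> e"
        by eventually_elim (rule inner[OF s1])
      ultimately show ?thesis by (rule tendsto_upperbound) simp
    qed
    then show ?thesis by (intro exI[of _ k]) auto
  qed
  then show thesis using that d(1) by blast
qed

lemma norm_funpow_blaschke_circle:
  assumes "norm w < 1" "norm z = 1"
  shows "norm ((blaschke n w ^^ k) z) = 1"
  by (induction k) (use assms norm_blaschke_eq_1 in auto)

theorem circle_subset_julia_interior_limit:
  assumes w: "norm w < 1" and n: "n \<ge> 1" and a: "norm a < 1"
    and conv: "\<And>z. norm z < 1 \<Longrightarrow> (\<lambda>k. (blaschke n w ^^ k) z) \<longlonglongrightarrow> a" and z: "norm \<zeta> = 1"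
  shows "Fin \<zeta> \<in> julia_set (blaschke_sphere n w)"
proof (rule ccontr)
  assume "\<not> ?thesis"
  then obtain d where d: "d > 0"
    "\<And>e. e > 0 \<Longrightarrow> \<exists>k. \<forall>z \<in> ball \<zeta> d \<inter> cball 0 1. norm ((blaschke n w ^^ k) z - a) \<le> e"
    using uniform_convergence_near_fatou_point[OF w n less_imp_le[OF a] conv] by metis
  obtain k where k: "\<forall>z \<in> ball \<zeta> d \<inter> cball 0 1. norm ((blaschke n w ^^ k) z - a) \<le> (1 - norm a) / 2"
    using d(2)[of "(1 - norm a) / 2"] a by (meson diff_gt_0_iff_gt half_gt_zero)
  have "\<zeta> \<in> ball \<zeta> d \<inter> cball 0 1" using z d(1) by simp
  then have "norm ((blaschke n w ^^ k) \<zeta> - a) \<le> (1 - norm a) / 2" by (rule bspec[OF k])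
  moreover have "norm ((blaschke n w ^^ k) \<zeta>) = 1" using norm_funpow_blaschke_circle[OF w z] .
  ultimately show False
    using norm_triangle_ineq2[of "(blaschke n w ^^ k) \<zeta>" a] a by (simp add: field_simps)
qed

text \<open>On the circle the logarithmic derivative \<open>z B' z / B z\<close> is real and positive: there
  \<open>z - w = z * cnj (1 - cnj w * z)\<close>, and the phases cancel.\<close>

lemma blaschke_deriv_circle:
  assumes w: "norm w < 1" and z: "norm z = 1" and n: "n \<ge> 1"
  shows "(blaschke n w has_field_derivative of_real (dilation n w z) * blaschke n w z / z) (at z)"
proof -
  define q where "q = 1 - cnj w * z"
  define q' where "q' = cnj q"
  define s where "s = 1 - cnj w * w"
  define m where "m = mob w z"
  have q: "q \<noteq> 0" unfolding q_def using mob_denom_nonzero[OF w, of z] z by simp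
  then have q': "q' \<noteq> 0" by (simp add: q'_def)
  have z0: "z \<noteq> 0" using z by auto
  have "z * cnj z = 1" using complex_norm_square[of z] z by simp
  then have zw: "z - w = z * q'" by (simp add: q'_def q_def algebra_simps)
  then have m: "m = z * q' / q" by (simp add: m_def mob_def q_def)
  have "complex_of_real (1 - (norm w)\<^sup>2) = s"
    unfolding s_def using complex_norm_square[of w] by (simp add: mult.commute)
  then have D: "complex_of_real (dilation n w z) = of_nat n * s / (q * q')"
    unfolding dilation_on_circle[OF w z] q_def[symmetric] q'_def
    by (simp add: complex_norm_square[symmetric] del: of_real_diff)
  have "((\<lambda>z. z - w) has_field_derivative 1) (at z)"
    by (auto intro!: derivative_eq_intros)
  moreover have "((\<lambda>z. 1 - cnj w * z) has_field_derivative - cnj w) (at z)"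
    by (auto intro!: derivative_eq_intros)
  ultimately have "((\<lambda>z. (z - w) / (1 - cnj w * z)) has_field_derivative
      (1 * (1 - cnj w * z) - (z - w) * - cnj w) / ((1 - cnj w * z) * (1 - cnj w * z))) (at z)"
    using q unfolding q_def by (rule DERIV_divide)
  moreover have "1 * (1 - cnj w * z) - (z - w) * - cnj w = s"
    by (simp add: s_def algebra_simps)
  ultimately have "((\<lambda>z. (z - w) / (1 - cnj w * z)) has_field_derivative s / (q * q)) (at z)"
    unfolding q_def by simp
  from DERIV_power[OF this, of n]
  have "(blaschke n w has_field_derivative of_nat n * (s / (q * q) * m ^ (n - 1))) (at z)"
    unfolding blaschke_def[abs_def] m_def mob_def by simp
  moreover have "of_nat n * (s / (q * q) * m ^ (n - 1)) = of_real (dilation n w z) * blaschke n w z / z"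
  proof -
    have "of_real (dilation n w z) * m / z = of_nat n * (s / (q * q))"
      unfolding D m using q q' z0 by simp
    moreover have "blaschke n w z = m * m ^ (n - 1)"
      unfolding blaschke_eq_mob m_def using n by (cases n) auto
    then have "of_real (dilation n w z) * blaschke n w z / z = of_real (dilation n w z) * m / z * m ^ (n - 1)"
      by simp
    ultimately show ?thesis by (simp only: mult.assoc)
  qed
  ultimately show ?thesis by (simp only:)
qed

text \<open>Along the curves \<open>h t = (B ^^ k) (cis t)\<close> one has \<open>h' = \<i> c h\<close> with \<open>c \<ge> 1\<close>, so the argument of \<open>h\<close>
  increases at unit speed or faster. Near \<open>a\<close> this makes \<open>Im (h / a)\<close> grow at a rate of at least \<open>1/2\<close>, which contradicts
  the uniform smallness of \<open>h - a\<close> on an arc.\<close>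

theorem circle_subset_julia_expanding:
  assumes w: "norm w < 1" and n: "n \<ge> 1" and a: "norm a = 1"
    and conv: "\<And>z. norm z < 1 \<Longrightarrow> (\<lambda>k. (blaschke n w ^^ k) z) \<longlonglongrightarrow> a" and z: "norm \<zeta> = 1"
    and expand: "\<And>z. norm z = 1 \<Longrightarrow> dilation n w z \<ge> 1"
  shows "Fin \<zeta> \<in> julia_set (blaschke_sphere n w)"
proof (rule ccontr)
  let ?b = "blaschke n w"
  assume "\<not> ?thesis"
  then obtain d where d: "d > 0"
    "\<And>e. e > 0 \<Longrightarrow> \<exists>k. \<forall>z \<in> ball \<zeta> d \<inter> cball 0 1. norm ((?b ^^ k) z - a) \<le> e"
    using uniform_convergence_near_fatou_point[OF w n _ conv] a by (metis order_refl)
  have a0: "a \<noteq> 0" using a by auto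
  have h1: "norm ((?b ^^ k) (cis t)) = 1" for k t using norm_funpow_blaschke_circle[OF w] by simp
  have der: "\<exists>c\<ge>1. ((\<lambda>t. (?b ^^ k) (cis t)) has_vector_derivative (of_real c * \<i> * (?b ^^ k) (cis t))) (at t)"
    for k t
  proof (induction k)
    case 0
    have "(cis has_vector_derivative (of_real 1 * \<i> * cis t)) (at t)"
      unfolding cis_conv_exp[abs_def]
      by (rule derivative_eq_intros has_vector_derivative_real_field | simp)+
    then show ?case by (intro exI[of _ 1]) simp
  next
    case (Suc k)
    define h where "h = (?b ^^ k) (cis t)"
    have h: "norm h = 1" "h \<noteq> 0" using h1[of k t] by (auto simp: h_def)
    obtain c where c: "c \<ge> 1" "((\<lambda>t. (?b ^^ k) (cis t)) has_vector_derivative (of_real c * \<i> * h)) (at t)"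
      using Suc by (auto simp: h_def)
    define D where "D = dilation n w h"
    have D: "D \<ge> 1" using expand[OF h(1)] by (simp add: D_def)
    have "(?b \<circ> (\<lambda>t. (?b ^^ k) (cis t)) has_vector_derivative
        (of_real c * \<i> * h) * (of_real D * ?b h / h)) (at t)"
      using c(2) blaschke_deriv_circle[OF w h(1) n] unfolding D_def h_def
      by (rule field_vector_diff_chain_at)
    moreover have "(of_real c * \<i> * h) * (of_real D * ?b h / h) = of_real (c * D) * \<i> * ?b h"
      using h(2) by simp
    moreover have "c * D \<ge> 1" using c(1) D mult_mono[of 1 c 1 D] by simp
    ultimately show ?case by (intro exI[of _ "c * D"]) (simp add: o_def h_def)
  qed
  define t0 where "t0 = Arg2pi \<zeta>"
  have t0: "cis t0 = \<zeta>" using z complex_norm_eq_1_exp[of \<zeta>] by (simp add: t0_def cis_conv_exp)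
  have near: "cis t \<in> ball \<zeta> d \<inter> cball 0 1" if "t0 \<le> t" "t \<le> t0 + d / 2" for t
  proof -
    have "norm (cis t - cis t0) \<le> \<bar>t - t0\<bar>"
    proof -
      have "cis t - cis t0 = cis t0 * (cis (t - t0) - 1)" by (simp add: cis_mult algebra_simps)
      then have "norm (cis t - cis t0) = norm (cis (t - t0) - 1)" by (simp add: norm_mult)
      also have "\<dots> \<le> \<bar>t - t0\<bar>"
        using dist_exp_i_1[of "t - t0"] abs_sin_x_le_abs_x[of "(t - t0) / 2"] by (simp add: cis_conv_exp)
      finally show ?thesis .
    qed
    also have "\<dots> < d" using that d(1) by simp
    finally show ?thesis using t0 by (simp add: dist_norm norm_minus_commute)
  qed
  \<comment> \<open>the imaginary part of \<open>q\<close> grows by \<open>d / 4\<close> along the arc, but stays within \<open>d / 16\<close> of \<open>0\<close>\<close>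
  define e where "e = min (1 / 2) (d / 16)"
  have e: "e > 0" "e \<le> 1 / 2" "e \<le> d / 16" using d(1) by (auto simp: e_def)
  obtain k where k: "\<And>z. z \<in> ball \<zeta> d \<inter> cball 0 1 \<Longrightarrow> norm ((?b ^^ k) z - a) \<le> e"
    using d(2)[OF e(1)] by blast
  define q where "q = (\<lambda>t. (?b ^^ k) (cis t) / a)"
  have q: "norm (q t - 1) \<le> e" if "t0 \<le> t" "t \<le> t0 + d / 2" for t
  proof -
    have "q t - 1 = ((?b ^^ k) (cis t) - a) / a" unfolding q_def using a0 by (simp add: diff_divide_distrib)
    then show ?thesis using k[OF near[OF that]] a by (simp add: norm_divide)
  qed
  obtain c where c: "\<And>t. c t \<ge> 1"
    "\<And>t. ((\<lambda>t. (?b ^^ k) (cis t)) has_vector_derivative (of_real (c t) * \<i> * (?b ^^ k) (cis t))) (at t)"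
    using der[of k] by metis
  have dIm: "((\<lambda>t. Im (q t)) has_real_derivative c t * Re (q t)) (at t)" for t
  proof -
    have "((\<lambda>t. (?b ^^ k) (cis t) / a) has_vector_derivative (of_real (c t) * \<i> * (?b ^^ k) (cis t)) / a) (at t)"
      using c(2)[of t] by (rule has_vector_derivative_divide)
    then have "((\<lambda>t. Im (q t)) has_vector_derivative Im ((of_real (c t) * \<i> * (?b ^^ k) (cis t)) / a)) (at t)"
      unfolding q_def by (rule bounded_linear.has_vector_derivative[OF bounded_linear_Im])
    moreover have "(of_real (c t) * \<i> * (?b ^^ k) (cis t)) / a = of_real (c t) * (\<i> * q t)"
      by (simp add: q_def)
    ultimately show ?thesis by (simp add: has_real_derivative_iff_has_vector_derivative)
  qed
  obtain s where s: "t0 < s" "s < t0 + d / 2"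
    "Im (q (t0 + d / 2)) - Im (q t0) = (t0 + d / 2 - t0) * (c s * Re (q s))"
    using MVT2[of t0 "t0 + d / 2" "\<lambda>t. Im (q t)" "\<lambda>t. c t * Re (q t)"] dIm d(1) by auto
  have "Re (q s) \<ge> 1 / 2"
    using q[of s] s(1,2) e(2) abs_Re_le_cmod[of "q s - 1"] by simp
  then have "1 * (1 / 2) \<le> c s * Re (q s)" using c(1)[of s] by (intro mult_mono) auto
  then have "d / 2 * (1 * (1 / 2)) \<le> d / 2 * (c s * Re (q s))" using d(1) by (intro mult_left_mono) auto
  moreover have "\<bar>Im (q t)\<bar> \<le> d / 16" if "t0 \<le> t" "t \<le> t0 + d / 2" for t
    using q[OF that] abs_Im_le_cmod[of "q t - 1"] e(3) by simp
  from this[of t0] this[of "t0 + d / 2"] have "Im (q (t0 + d / 2)) - Im (q t0) \<le> d / 8"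
    using d(1) by simp
  ultimately show False using s(3) d(1) by simp
qed

section \<open>Circle points in the Fatou set\<close>

lemma binomial_second_order:
  "\<exists>p. continuous_on UNIV p \<and> (\<forall>y::complex. (1 + y) ^ n = 1 + of_nat n * y + y\<^sup>2 * p y)"
proof (induction n)
  case 0
  show ?case by (intro exI[of _ "\<lambda>_. 0"]) simp
next
  case (Suc n)
  then obtain p where p: "continuous_on UNIV p" "\<And>y::complex. (1 + y) ^ n = 1 + of_nat n * y + y\<^sup>2 * p y"
    by blast
  have "(1 + y) ^ Suc n = 1 + of_nat (Suc n) * y + y\<^sup>2 * (of_nat n + (1 + y) * p y)" for y :: complex
    unfolding power_Suc p(2) of_nat_Suc by (simp add: power2_eq_square algebra_simps)
  moreover have "continuous_on UNIV (\<lambda>y. of_nat n + (1 + y) * p y)" by (intro continuous_intros p(1))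
  ultimately show ?case by (intro exI[of _ "\<lambda>y. of_nat n + (1 + y) * p y"] conjI allI)
qed

text \<open>With \<open>v = 1 / s\<close> the quotient \<open>(s + x) / (s - x)\<close> is \<open>(1 + x v) / (1 - x v)\<close>. The expression
  \<open>1 / (\<rho> - 1) + 1 / 2 = (\<rho> + 1) / (2 (\<rho> - 1))\<close> with \<open>\<rho> = ((s + x) / (s - x)) ^ n\<close> is odd in
  \<open>s\<close>, so its expansion at infinity has a linear but no constant term.\<close>

lemma power_moebius_at_infinity:
  fixes x e :: real
  assumes x: "x > 0" and n: "n \<ge> 1" and e: "e > 0"
  obtains M where "M > 0"
    "\<And>s :: complex. norm s > M \<Longrightarrow> s \<noteq> of_real x \<and> ((s + of_real x) / (s - of_real x)) ^ n \<noteq> 1 \<and>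
      norm (1 / (((s + of_real x) / (s - of_real x)) ^ n - 1) + 1 / 2 - s / of_real (2 * real n * x)) < e"
proof -
  define X where "X = complex_of_real x"
  define N where "N = (of_nat n :: complex)"
  have X: "X \<noteq> 0" using x by (simp add: X_def)
  have N: "N \<noteq> 0" using n by (simp add: N_def)
  obtain p where p_ex: "continuous_on UNIV p \<and> (\<forall>y::complex. (1 + y) ^ n = 1 + of_nat n * y + y\<^sup>2 * p y)"
    using binomial_second_order[of n] by (elim exE)
  have p_continuous: "continuous_on UNIV p" by (rule conjunct1[OF p_ex])
  have p_expand: "(1 + y) ^ n = 1 + N * y + y\<^sup>2 * p y" for y
    unfolding N_def by (rule conjunct2[OF p_ex, THEN spec])
  \<comment> \<open>\<open>2 n x v E\<close> is the difference of the \<open>n\<close>-th powers of \<open>1 + x v\<close> and \<open>1 - x v\<close>, and \<open>G\<close> is the error term\<close>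
  define E where "E = (\<lambda>v. 1 + X * v / (2 * N) * (p (X * v) - p (- X * v)))"
  define G where "G = (\<lambda>v. (X * v * (p (X * v) + p (- X * v)) / 2 - (p (X * v) - p (- X * v)) / (2 * N)) / (2 * N * E v))"
  have p_cont: "isCont p y" for y using p_continuous by (simp add: continuous_on_eq_continuous_at)
  have pc: "isCont (\<lambda>v. p (X * v)) 0" "isCont (\<lambda>v. p (- X * v)) 0"
    by (rule isCont_o2[OF _ p_cont], intro continuous_intros)+
  have Ec: "isCont E 0" unfolding E_def using N by (intro continuous_intros pc) auto
  have E0: "E 0 = 1" by (simp add: E_def)
  have Gc: "isCont G 0" unfolding G_def using N E0 by (intro continuous_intros pc Ec) auto
  have G0: "G 0 = 0" by (simp add: G_def)
  have "\<forall>\<^sub>F v in at 0. E v \<noteq> 0"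
    using Ec E0 tendsto_imp_eventually_ne[of E 1 "at 0" 0] by (simp add: isCont_def)
  moreover have "\<forall>\<^sub>F v in at 0. norm (G v) < e"
    using Gc G0 order_tendstoD(2)[OF tendsto_norm, of G 0 "at 0" e] e by (simp add: isCont_def)
  moreover have "\<forall>\<^sub>F v in at 0. 1 - X * v \<noteq> 0"
  proof -
    have "((\<lambda>v. 1 - X * v) \<longlongrightarrow> 1 - X * 0) (at 0)" by (intro tendsto_intros)
    then show ?thesis by (intro tendsto_imp_eventually_ne[of _ 1]) simp_all
  qed
  ultimately have "\<forall>\<^sub>F v in at 0. E v \<noteq> 0 \<and> norm (G v) < e \<and> 1 - X * v \<noteq> 0"
    by (intro eventually_conj)
  then obtain d where d: "d > 0"
    "\<And>v. v \<noteq> 0 \<Longrightarrow> norm v < d \<Longrightarrow> E v \<noteq> 0 \<and> norm (G v) < e \<and> 1 - X * v \<noteq> 0"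
    unfolding eventually_at dist_norm diff_zero by (metis UNIV_I)
  show thesis
  proof (rule that[of "1 / d"])
    show "1 / d > 0" using d(1) by simp
    fix s :: complex assume s: "norm s > 1 / d"
    then have s0: "s \<noteq> 0" using d(1) by auto
    define v where "v = 1 / s"
    have v: "v \<noteq> 0" "s = 1 / v" using s0 by (simp_all add: v_def)
    have "norm v < d" unfolding v_def norm_divide norm_one using s d(1) s0
      by (simp add: divide_less_eq mult.commute)
    then have Ev: "E v \<noteq> 0" and Gv: "norm (G v) < e" and Qv: "1 - X * v \<noteq> 0" using d(2) v(1) by auto
    define P where "P = (1 + X * v) ^ n"
    define Q where "Q = (1 + (- X * v)) ^ n"
    have Q: "Q \<noteq> 0" unfolding Q_def using Qv by simp
    have sx: "s - X = (1 - X * v) / v" "s + X = (1 + X * v) / v" using v by (simp_all add: field_simps)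
    then have r: "((s + X) / (s - X)) ^ n = P / Q" unfolding P_def Q_def using v(1) by (simp add: power_divide)
    define a where "a = p (X * v)"
    define b where "b = p (- X * v)"
    have PQ: "P - Q = 2 * N * X * v * E v"
    proof -
      have "P - Q = 2 * N * X * v + (X * v)\<^sup>2 * (a - b)"
        unfolding P_def Q_def p_expand a_def b_def by (simp add: power2_eq_square algebra_simps)
      also have "\<dots> = 2 * N * X * v * E v"
        unfolding E_def a_def[symmetric] b_def[symmetric] using N by (simp add: field_simps power2_eq_square)
      finally show ?thesis .
    qed
    have PpQ: "P + Q = 2 + (X * v)\<^sup>2 * (a + b)"
      unfolding P_def Q_def p_expand a_def b_def by (simp add: power2_eq_square algebra_simps)
    have PQ0: "P - Q \<noteq> 0" unfolding PQ using N X v(1) Ev by simp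
    have EE: "E v = 1 + X * v / (2 * N) * (a - b)" by (simp add: E_def a_def b_def)
    have "1 / (P / Q - 1) + 1 / 2 = (P + Q) / (2 * (P - Q))"
      using PQ0 Q by (simp add: field_simps)
    also have "\<dots> = (1 + (X * v)\<^sup>2 * (a + b) / 2) / (2 * N * X * v * E v)"
      unfolding PQ PpQ using N X v(1) Ev by (simp add: field_simps)
    also have "\<dots> - s / (2 * N * X) = ((1 + (X * v)\<^sup>2 * (a + b) / 2) - E v) / (2 * N * X * v * E v)"
      unfolding v(2) using N X v(1) Ev by (simp add: diff_divide_distrib)
    also have "(1 + (X * v)\<^sup>2 * (a + b) / 2) - E v = (X * v) * (X * v * (a + b) / 2 - (a - b) / (2 * N))"
      unfolding EE by (simp add: power2_eq_square algebra_simps)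
    also have "\<dots> / (2 * N * X * v * E v) = (X * v * (a + b) / 2 - (a - b) / (2 * N)) / (2 * N * E v)"
      using N X v(1) Ev by (simp add: divide_simps)
    also have "\<dots> = G v" unfolding G_def a_def b_def by simp
    finally have main: "1 / (P / Q - 1) + 1 / 2 - s / (2 * N * X) = G v" .
    have "P / Q \<noteq> 1" using PQ0 Q by simp
    moreover have "s \<noteq> X" using sx(1) Qv v(1) by auto
    moreover have "2 * N * X = of_real (2 * real n * x)" by (simp add: N_def X_def)
    ultimately show "s \<noteq> of_real x \<and> ((s + of_real x) / (s - of_real x)) ^ n \<noteq> 1 \<and>
      norm (1 / (((s + of_real x) / (s - of_real x)) ^ n - 1) + 1 / 2 - s / of_real (2 * real n * x)) < e"
      using main Gv r unfolding X_def[symmetric] by metis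
  qed
qed

text \<open>The chart \<open>T = \<zeta> / (z - \<zeta>)\<close> maps the unit circle to the line \<open>Re T = - 1 / 2\<close>. The shift
  \<open>s = T + A - x = T + 1 / 2 + \<i> Im A\<close> puts the zero and the pole of the automorphism at the symmetric
  positions \<open>- x\<close> and \<open>x\<close>.\<close>

lemma blaschke_in_boundary_chart:
  assumes w: "norm w < 1" and \<zeta>: "norm \<zeta> = 1" and fixed: "blaschke n w \<zeta> = \<zeta>"
    and n: "n \<ge> 1"
    and A: "A = 1 / (1 - w * cnj \<zeta>)" and x: "x = Re A - 1 / 2"
  shows "dilation n w \<zeta> = 2 * real n * x" "x > 0"
    and "\<And>z T s. \<lbrakk>z \<noteq> \<zeta>; T = \<zeta> / (z - \<zeta>); s = T + A - of_real x; s \<noteq> of_real x\<rbrakk>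
      \<Longrightarrow> 1 - cnj w * z \<noteq> 0 \<and> blaschke n w z = \<zeta> * ((s + of_real x) / (s - of_real x)) ^ n"
proof -
  define \<beta> where "\<beta> = 1 - w * cnj \<zeta>"
  have \<zeta>0: "\<zeta> \<noteq> 0" using \<zeta> by auto
  have \<zeta>\<zeta>: "\<zeta> * cnj \<zeta> = 1" using complex_norm_square[of \<zeta>] \<zeta> by simp
  have cb: "cnj \<beta> = 1 - cnj w * \<zeta>" by (simp add: \<beta>_def)
  have cb0: "cnj \<beta> \<noteq> 0" unfolding cb using mob_denom_nonzero[OF w, of \<zeta>] \<zeta> by simp
  then have b0: "\<beta> \<noteq> 0" by simp
  have nb: "norm (1 - cnj w * \<zeta>) = norm \<beta>" unfolding cb[symmetric] by simp
  have nb0: "(norm \<beta>)\<^sup>2 > 0" using b0 by simp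
  have A': "A = 1 / \<beta>" by (simp add: A \<beta>_def)
  have ReA: "Re A = Re \<beta> / (norm \<beta>)\<^sup>2" unfolding A' by (simp add: Re_divide cmod_power2)
  have "norm (1 - \<beta>) = norm w" unfolding \<beta>_def using \<zeta> by (simp add: norm_mult)
  then have "(norm w)\<^sup>2 = (norm (1 - \<beta>))\<^sup>2" by simp
  also have "\<dots> = 1 - 2 * Re \<beta> + (norm \<beta>)\<^sup>2"
    unfolding cmod_power2 by (simp add: power2_eq_square algebra_simps)
  finally have nw: "1 - (norm w)\<^sup>2 = 2 * Re \<beta> - (norm \<beta>)\<^sup>2" by simp
  have x2: "2 * x = (1 - (norm w)\<^sup>2) / (norm \<beta>)\<^sup>2"
    unfolding x ReA nw using nb0 by (simp add: diff_divide_distrib)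
  have "2 * real n * x = real n * (2 * x)" by simp
  also have "\<dots> = dilation n w \<zeta>"
    unfolding x2 dilation_on_circle[OF w \<zeta>] nb by simp
  finally show "dilation n w \<zeta> = 2 * real n * x" by simp
  have "1 - (norm w)\<^sup>2 > 0" using w by (simp add: abs_square_less_1)
  then have "2 * x > 0" unfolding x2 using nb0 by (rule divide_pos_pos)
  then show "x > 0" by simp
  fix z T s assume z: "z \<noteq> \<zeta>" and T: "T = \<zeta> / (z - \<zeta>)" and s: "s = T + A - of_real x" and sx: "s \<noteq> of_real x"
  have T0: "T \<noteq> 0" using \<zeta>0 z by (simp add: T)
  have zT: "z = \<zeta> + \<zeta> / T" using z \<zeta>0 by (simp add: T)
  have "A + cnj A = of_real (2 * Re A)" by (rule complex_add_cnj)
  also have "\<dots> = 1 + 2 * of_real x" by (simp add: x)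
  finally have AA: "A - of_real x - of_real x = 1 - cnj A" by (simp add: algebra_simps)
  have cA: "cnj A = 1 / cnj \<beta>" by (simp add: A')
  have sx2: "s - of_real x = T + 1 - 1 / cnj \<beta>" unfolding s using AA cA by (simp add: algebra_simps)
  have sx1: "s + of_real x = T + 1 / \<beta>" unfolding s A' by simp
  have den: "1 - cnj w * z = cnj \<beta> * ((s - of_real x) / T)"
  proof -
    have "1 - cnj w * z = (1 - cnj w * \<zeta>) - cnj w * \<zeta> / T" unfolding zT by (simp add: algebra_simps)
    also have "\<dots> = cnj \<beta> - (1 - cnj \<beta>) / T" unfolding cb by simp
    also have "\<dots> = cnj \<beta> * ((s - of_real x) / T)" unfolding sx2 using cb0 T0 by (simp add: field_simps)
    finally show ?thesis .
  qed
  have num: "z - w = \<zeta> * \<beta> * ((s + of_real x) / T)"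
  proof -
    have "\<zeta> * \<beta> = \<zeta> - w" unfolding \<beta>_def using \<zeta>\<zeta> by (simp add: algebra_simps)
    moreover have "\<zeta> * \<beta> * ((s + of_real x) / T) = \<zeta> * \<beta> + \<zeta> / T" unfolding sx1 using b0 T0 by (simp add: field_simps)
    ultimately show ?thesis by (simp add: zT)
  qed
  have num0: "\<zeta> - w = \<zeta> * \<beta>" unfolding \<beta>_def using \<zeta>\<zeta> by (simp add: algebra_simps)
  have sx0: "s - of_real x \<noteq> 0" using sx by simp
  have "mob w z = mob w \<zeta> * ((s + of_real x) / (s - of_real x))"
    unfolding mob_def num den num0 cb[symmetric] using T0 by simp
  then have "blaschke n w z = blaschke n w \<zeta> * ((s + of_real x) / (s - of_real x)) ^ n"
    by (simp only: blaschke_eq_mob power_mult_distrib)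
  moreover have "1 - cnj w * z \<noteq> 0" unfolding den using cb0 T0 sx0 by simp
  ultimately show "1 - cnj w * z \<noteq> 0 \<and> blaschke n w z = \<zeta> * ((s + of_real x) / (s - of_real x)) ^ n"
    using fixed by simp
qed

text \<open>Choice of the half plane \<open>\<sigma> Im T > R\<close>: expansion by \<open>1 / d\<close> beats any bounded error if \<open>d < 1\<close>, and for
  \<open>d = 1\<close> the half plane has to open in the direction of the drift \<open>y\<close>. The error bound \<open>e\<close> is fixed before \<open>R\<close>,
  because the threshold \<open>M\<close> depends on it.\<close>

lemma drift_direction:
  fixes d y :: real
  assumes "0 < d" "d \<le> 1" "\<not> (d = 1 \<and> y = 0)"
  obtains \<sigma> e where "\<bar>\<sigma>\<bar> = 1" "e > 0" "\<And>M. \<exists>R>0. R \<ge> M + \<bar>y\<bar> \<and> (R + \<sigma> * y) / d - e \<ge> R"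
proof (cases "d = 1")
  case True
  then have y: "y \<noteq> 0" using assms by simp
  show thesis
  proof (rule that[of "sgn y" "\<bar>y\<bar>"])
    fix M
    show "\<exists>R>0. R \<ge> M + \<bar>y\<bar> \<and> (R + sgn y * y) / d - \<bar>y\<bar> \<ge> R"
      using True by (intro exI[of _ "max 1 (M + \<bar>y\<bar>)"]) (simp add: abs_sgn mult.commute)
  qed (use y in \<open>auto simp: abs_sgn_eq\<close>)
next
  case False
  then have d: "d < 1" using assms by simp
  show thesis
  proof (rule that[of 1 1])
    fix M
    define R where "R = max (max 1 (M + \<bar>y\<bar>)) ((d - y) / (1 - d))"
    have R: "R \<ge> 1" "R \<ge> M + \<bar>y\<bar>" by (simp_all add: R_def)
    have "(d - y) / (1 - d) \<le> R" by (simp add: R_def)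
    then have "d - y \<le> R * (1 - d)" using d by (simp add: pos_divide_le_eq)
    then have "(R + 1) * d \<le> R + y" by (simp add: algebra_simps)
    then have "R + 1 \<le> (R + y) / d" using assms(1) by (simp add: pos_le_divide_eq)
    then show "\<exists>R>0. R \<ge> M + \<bar>y\<bar> \<and> (R + 1 * y) / d - 1 \<ge> R"
      using R by (intro exI[of _ R]) simp
  qed auto
qed

text \<open>The set \<open>V\<close> in the proof is the half plane \<open>\<sigma> Im T > R\<close>, which in the \<open>z\<close>-plane is a disc tangent
  at \<open>\<zeta>\<close> to the radial line through \<open>\<zeta>\<close>, so it contains an arc of the circle on one side of \<open>\<zeta>\<close>. In the
  parabolic case only one side is attracted to \<open>\<zeta>\<close>, hence the sign \<open>\<sigma>\<close>.\<close>

theorem circle_point_in_fatou_set: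
  assumes w: "norm w < 1" and n: "n \<ge> 1" and \<zeta>: "norm \<zeta> = 1" and fixed: "blaschke n w \<zeta> = \<zeta>"
    and dil: "dilation n w \<zeta> \<le> 1" and nondeg: "\<not> (dilation n w \<zeta> = 1 \<and> Im (w * cnj \<zeta>) = 0)"
  shows "\<exists>z. norm z = 1 \<and> Fin z \<notin> julia_set (blaschke_sphere n w)"
proof -
  define A where "A = 1 / (1 - w * cnj \<zeta>)"
  define x where "x = Re A - 1 / 2"
  define y where "y = Im A"
  define d where "d = 2 * real n * x"
  note chart = blaschke_in_boundary_chart[OF w \<zeta> fixed n A_def x_def]
  have x: "x > 0" by (rule chart(2))
  have d: "0 < d" "d \<le> 1" unfolding d_def using x n chart(1) dil by auto
  have y0: "Im (w * cnj \<zeta>) = 0" if "y = 0"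
  proof -
    have "A \<noteq> 0" using x unfolding x_def by auto
    then have "w * cnj \<zeta> = 1 - 1 / A" unfolding A_def by auto
    moreover have "Im (1 / A) = 0" using that by (simp add: Im_divide y_def)
    ultimately show ?thesis by simp
  qed
  have "\<not> (d = 1 \<and> y = 0)" using nondeg y0 chart(1) unfolding d_def by auto
  then obtain \<sigma> e where \<sigma>: "\<bar>\<sigma>\<bar> = 1" and e: "e > 0"
    and R_ex: "\<And>M. \<exists>R>0. R \<ge> M + \<bar>y\<bar> \<and> (R + \<sigma> * y) / d - e \<ge> R"
    using drift_direction[OF d] by metis
  obtain M where M: "M > 0"
    "\<And>s :: complex. norm s > M \<Longrightarrow> s \<noteq> of_real x \<and> ((s + of_real x) / (s - of_real x)) ^ n \<noteq> 1 \<and>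
      norm (1 / (((s + of_real x) / (s - of_real x)) ^ n - 1) + 1 / 2 - s / of_real d) < e"
    using power_moebius_at_infinity[OF x n e] unfolding d_def by metis
  obtain R where R: "R > 0" "R \<ge> M + \<bar>y\<bar>" "(R + \<sigma> * y) / d - e \<ge> R" using R_ex[of M] by blast
  define V where "V = - {\<zeta>} \<inter> (\<lambda>z. \<sigma> * Im (\<zeta> / (z - \<zeta>))) -` {R<..}"
  have \<zeta>0: "\<zeta> \<noteq> 0" using \<zeta> by auto
  have \<sigma>2: "\<sigma> * \<sigma> = 1" using \<sigma> by (metis abs_mult_self_eq mult_1_left)
  have step: "1 - cnj w * z \<noteq> 0 \<and> blaschke n w z \<in> V" if "z \<in> V" for z
  proof -
    define T where "T = \<zeta> / (z - \<zeta>)"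
    define s where "s = T + A - of_real x"
    have z: "z \<noteq> \<zeta>" "\<sigma> * Im T > R" using that by (auto simp: V_def T_def)
    have Ims: "Im s = Im T + y" by (simp add: s_def y_def)
    have Res: "s = T + 1 / 2 + \<i> * of_real y" by (simp add: s_def x_def y_def complex_eq_iff)
    have "\<sigma> * Im T \<le> \<bar>Im T\<bar>" using \<sigma> abs_ge_self[of "\<sigma> * Im T"] by (simp add: abs_mult)
    then have "norm s > M"
      using abs_Im_le_cmod[of s] R(2) z(2) unfolding Ims by linarith
    then have s: "s \<noteq> of_real x" "((s + of_real x) / (s - of_real x)) ^ n \<noteq> 1"
      "norm (1 / (((s + of_real x) / (s - of_real x)) ^ n - 1) + 1 / 2 - s / of_real d) < e"
      using M(2)[of s] by auto
    define \<rho> where "\<rho> = ((s + of_real x) / (s - of_real x)) ^ n"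
    define T' where "T' = 1 / (\<rho> - 1)"
    have b: "1 - cnj w * z \<noteq> 0" "blaschke n w z = \<zeta> * \<rho>"
      using chart(3)[OF z(1) T_def s_def s(1)] by (auto simp: \<rho>_def)
    have bT: "\<zeta> / (blaschke n w z - \<zeta>) = T'"
      unfolding b(2) T'_def using \<zeta>0 by (metis mult.right_neutral mult_divide_mult_cancel_left right_diff_distrib)
    have bz: "blaschke n w z \<noteq> \<zeta>" unfolding b(2) using s(2) \<zeta>0 by (simp add: \<rho>_def)
    have Im_e: "\<bar>Im (T' + 1 / 2 - s / of_real d)\<bar> < e"
      using s(3) abs_Im_le_cmod[of "T' + 1 / 2 - s / of_real d"] unfolding T'_def \<rho>_def by linarith
    have "Im (T' + 1 / 2 - s / of_real d) = Im T' - (Im T + y) / d"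
      by (simp add: Ims)
    then have "\<bar>\<sigma> * (Im T' - (Im T + y) / d)\<bar> < e"
      using Im_e unfolding abs_mult \<sigma> by (simp only: mult_1_left)
    then have "\<sigma> * Im T' > (\<sigma> * Im T + \<sigma> * y) / d - e"
      by (simp add: abs_less_iff algebra_simps add_divide_distrib)
    moreover have "(\<sigma> * Im T + \<sigma> * y) / d > (R + \<sigma> * y) / d"
      using z(2) d(1) by (intro divide_strict_right_mono) auto
    ultimately have "\<sigma> * Im T' > R" using R(3) by linarith
    then show ?thesis using b(1) bz bT by (simp add: V_def)
  qed
  have "continuous_on (- {\<zeta>}) (\<lambda>z. \<sigma> * Im (\<zeta> / (z - \<zeta>)))" by (intro continuous_intros) auto
  then have "open V" unfolding V_def by (intro continuous_open_preimage) auto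
  have "V \<subseteq> ball \<zeta> (1 / R)"
  proof
    fix z assume "z \<in> V"
    then have z: "z \<noteq> \<zeta>" "\<sigma> * Im (\<zeta> / (z - \<zeta>)) > R" by (auto simp: V_def)
    have "\<sigma> * Im (\<zeta> / (z - \<zeta>)) \<le> \<bar>Im (\<zeta> / (z - \<zeta>))\<bar>"
      using \<sigma> abs_ge_self[of "\<sigma> * Im (\<zeta> / (z - \<zeta>))"] by (simp add: abs_mult)
    also have "\<dots> \<le> 1 / norm (z - \<zeta>)" using abs_Im_le_cmod[of "\<zeta> / (z - \<zeta>)"] \<zeta> by (simp add: norm_divide)
    finally have "R < 1 / norm (z - \<zeta>)" using z(2) by simp
    then have "norm (z - \<zeta>) < 1 / R" using R(1) z(1) by (simp add: field_simps)
    then show "z \<in> ball \<zeta> (1 / R)" by (simp add: dist_norm norm_minus_commute)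
  qed
  then have "bounded V" using bounded_ball bounded_subset by blast
  \<comment> \<open>a point of \<open>V\<close> on the circle: the chart value has real part \<open>- 1 / 2\<close>\<close>
  define T0 where "T0 = Complex (- 1 / 2) (\<sigma> * (R + 1))"
  define z0 where "z0 = \<zeta> + \<zeta> / T0"
  have T0: "T0 \<noteq> 0" by (simp add: T0_def complex_eq_iff)
  have "norm (T0 + 1) = norm T0" by (simp add: T0_def cmod_def power2_eq_square)
  moreover have "z0 = \<zeta> * ((T0 + 1) / T0)" unfolding z0_def using T0 by (simp add: field_simps)
  ultimately have nz0: "norm z0 = 1" using \<zeta> T0 by (simp add: norm_mult norm_divide)
  have "\<zeta> / (z0 - \<zeta>) = T0" "z0 \<noteq> \<zeta>" unfolding z0_def using \<zeta>0 T0 by auto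
  moreover have "\<sigma> * Im T0 = R + 1" unfolding T0_def using \<sigma>2 by (simp add: mult.assoc[symmetric])
  ultimately have "z0 \<in> V" by (simp add: V_def)
  then have "Fin z0 \<notin> julia_set (blaschke_sphere n w)"
    using step by (intro bounded_invariant_disjoint_julia[OF \<open>open V\<close> \<open>bounded V\<close>]) blast+
  then show ?thesis using nz0 by blast
qed

section \<open>The locus of parameters with Julia set the unit circle\<close>

lemma degenerate_boundary_fixed_point:
  assumes w: "norm w < 1" and a: "norm a = 1" and n: "n \<ge> 2"
    and dil: "dilation n w a = 1" and Im0: "Im (w * cnj a) = 0"
  shows "w = - of_real (critical_radius n) * a"
proof -
  define t where "t = Re (w * cnj a)"
  have aa: "cnj a * a = 1" using a complex_norm_square[of a] by (simp add: mult.commute)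
  have t: "w * cnj a = of_real t" using Im0 by (simp add: t_def complex_eq_iff)
  then have wt: "w = of_real t * a" using aa by (metis mult.assoc mult.right_neutral)
  have nt: "norm w = \<bar>t\<bar>" unfolding wt using a by (simp add: norm_mult)
  have "cnj w * a = of_real t" unfolding wt using aa by (simp add: mult.assoc)
  then have "norm (1 - cnj w * a) = \<bar>1 - t\<bar>" by (metis norm_of_real of_real_1 of_real_diff)
  moreover have t1: "1 - t > 0" using w nt by simp
  ultimately have "real n * (1 - t\<^sup>2) = (1 - t)\<^sup>2"
    using dil unfolding dilation_on_circle[OF w a] nt by (simp add: divide_eq_1_iff)
  then have "(1 - t) * (real n * (1 + t)) = (1 - t) * (1 - t)"
    by (simp add: power2_eq_square algebra_simps)
  then have "real n * (1 + t) = 1 - t" using t1 by simp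
  then have "t * (real n + 1) = - (real n - 1)" by (simp add: algebra_simps)
  then have "t = - critical_radius n" unfolding critical_radius_def using n by (simp add: field_simps)
  then show ?thesis using wt by simp
qed

lemma julia_set_elliptic:
  assumes w: "norm w < 1" and n: "n \<ge> 2" and ell: "elliptic (blaschke n w)"
  shows "julia_set (blaschke_sphere n w) = Fin ` sphere 0 1"
proof (rule equalityI)
  have n1: "n \<ge> 1" using n by simp
  show "julia_set (blaschke_sphere n w) \<subseteq> Fin ` sphere 0 1" by (rule julia_set_subset_circle[OF w n1])
  obtain a where a: "norm a < 1" "\<And>z. norm z < 1 \<Longrightarrow> (\<lambda>k. (blaschke n w ^^ k) z) \<longlonglongrightarrow> a"
    using ell unfolding elliptic_def is_denjoy_wolff_point_def by auto
  show "Fin ` sphere 0 1 \<subseteq> julia_set (blaschke_sphere n w)"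
    using circle_subset_julia_interior_limit[OF w n1 a] by auto
qed

lemma julia_set_parabolic_param:
  assumes n: "n \<ge> 2"
  shows "julia_set (blaschke_sphere n (parabolic_param n)) = Fin ` sphere 0 1"
proof (rule equalityI)
  have n1: "n \<ge> 1" using n by simp
  have w: "norm (parabolic_param n) < 1" by (rule sector_norm[OF parabolic_param_in_sector[OF n]])
  show "julia_set (blaschke_sphere n (parabolic_param n)) \<subseteq> Fin ` sphere 0 1"
    by (rule julia_set_subset_circle[OF w n1])
  have conv: "(\<lambda>k. (blaschke n (parabolic_param n) ^^ k) z) \<longlonglongrightarrow> parabolic_fixpoint n" if "norm z < 1" for z
    using parabolic_fixpoint_fixed[OF n] norm_parabolic_fixpoint[of n] that
    by (intro blaschke_iterates_tendsto[OF w n]) simp_all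
  have "Fin z \<in> julia_set (blaschke_sphere n (parabolic_param n))" if "norm z = 1" for z
    by (rule circle_subset_julia_expanding[OF w n1 norm_parabolic_fixpoint conv that
          dilation_ge_1_on_critical_circle[OF n norm_parabolic_param[OF n]]])
  then show "Fin ` sphere 0 1 \<subseteq> julia_set (blaschke_sphere n (parabolic_param n))" by auto
qed

lemma julia_circle_not_elliptic:
  assumes n: "n \<ge> 2" and w: "w \<in> sector n" and J: "julia_set (blaschke_sphere n w) = Fin ` sphere 0 1"
    and ne: "\<not> elliptic (blaschke n w)"
  shows "w = parabolic_param n"
proof -
  have w1: "norm w < 1" by (rule sector_norm[OF w])
  obtain a where a: "norm a = 1" "blaschke n w a = a" "dilation n w a \<le> 1"
    using ne not_elliptic_iff[OF w1 n] by blast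
  have "dilation n w a = 1 \<and> Im (w * cnj a) = 0"
  proof (rule ccontr)
    assume "\<not> ?thesis"
    then obtain z where "norm z = 1" "Fin z \<notin> julia_set (blaschke_sphere n w)"
      using circle_point_in_fatou_set[OF w1 _ a] n by auto
    then show False unfolding J by simp
  qed
  then have "w = - of_real (critical_radius n) * a" using degenerate_boundary_fixed_point[OF w1 a(1) n] by blast
  then show ?thesis using sector_antipodal_fixed_unique[OF n w a(1) _ a(2)] by blast
qed

theorem theorem1p5:
  fixes n :: nat
  assumes "n \<ge> 2"
  shows "\<exists>p. (top_of_set (sector n) frontier_of elliptic_locus n)
               \<inter> {w. norm w = (real n - 1) / (real n + 1)} = {p}
           \<and> p \<notin> elliptic_locus n
           \<and> circle_julia_locus n = elliptic_locus n \<union> {p}"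
proof (intro exI[of _ "parabolic_param n"] conjI)
  show "(top_of_set (sector n) frontier_of elliptic_locus n)
      \<inter> {w. norm w = (real n - 1) / (real n + 1)} = {parabolic_param n}"
    using frontier_elliptic_locus_critical[OF assms] unfolding critical_radius_def .
  show "parabolic_param n \<notin> elliptic_locus n" by (rule parabolic_param_not_elliptic[OF assms])
  show "circle_julia_locus n = elliptic_locus n \<union> {parabolic_param n}"
  proof (intro equalityI subsetI)
    fix w assume "w \<in> circle_julia_locus n"
    then show "w \<in> elliptic_locus n \<union> {parabolic_param n}"
      using julia_circle_not_elliptic[OF assms] unfolding circle_julia_locus_def elliptic_locus_def by blast
  next
    fix w assume "w \<in> elliptic_locus n \<union> {parabolic_param n}"
    then show "w \<in> circle_julia_locus n"
      using julia_set_elliptic[OF sector_norm assms] julia_set_parabolic_param[OF assms] parabolic_param_in_sector[OF assms]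
      unfolding circle_julia_locus_def elliptic_locus_def by blast
  qed
qed

end
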